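(* Let $\|\cdot\|_{\mathcal P}$ be a norm on $\mathbb{R}^2$ whose closed unit ball $\mathcal{P}$ is a quadrilateral with facets $\pm F_1,\pm F_2$. Let $G=(V,E)$ be a $\mathbb{Z}_2$-symmetric graph with action $\theta:\mathbb{Z}_2\to\mathrm{Aut}(G)$, and let $(G,p)$ be a well-positioned bar-joint framework in $(\mathbb{R}^2,\|\cdot\|_{\mathcal P})$ which is $\mathbb{Z}_2$-symmetric with respect to $\theta$ and a representation $\tau:\mathbb{Z}_2\to\mathrm{Isom}(\mathbb{R}^2,\|\cdot\|_{\mathcal P})$. Suppose that $\theta$ acts freely on $V$ and that $\tau(-1)$ is a reflection in the mirror $\ker\varphi_{F_1}$ along $\ker\varphi_{F_2}$. The following are equivalent. (i) $(G,p)$ is anti-symmetrically isostatic. (ii) $G_{F_1,0}$ is a spanning tree in $G_0$ and $G_{F_2,0}$ is a spanning unbalanced map graph in $G_0$.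
   Context: **Graphs.** $G=(V,E)$ is a finite simple undirected graph. $\mathbb{Z}_2=\{1,-1\}$ (multiplicative). A $\mathbb{Z}_2$-symmetric graph is a graph $G$ with a homomorphism $\theta:\mathbb{Z}_2\to\mathrm{Aut}(G)$; write $-v=\theta(-1)v$ and $-e=(-v)(-w)$ for $e=vw\in E$. The action is free on $V$: $v\ne -v$ for all $v$. An edge $e$ with $e=-e$ is called fixed (such edges are allowed). Orbits are $[v]=\{v,-v\}$, $[e]=\{e,-e\}$; $V_0,E_0$ are the sets of vertex and edge orbits. The quotient graph $G_0$ has vertex set $V_0$ and edge set $E_0$, with $[e]$ incident to $[v]$ if $e$ is incident to $v$ or $-v$; it may have loops (from fixed edges) and parallel edges. Given a set $\tilde V_0$ of representatives of the vertex orbits, the gain $\psi:E_0\to\mathbb{Z}_2$ is $\psi_{[e]}=1$ if $e$ or $-e$ joins two vertices of $\tilde V_0$, and $\psi_{[e]}=-1$ otherwise (so loops have gain $-1$). The gain of a cycle is the product of the gains of its edges (loops are cycles of length 1, pairs of parallel edges are cycles of length 2). An edge set or subgraph is balanced if each of its cycles (if any) has gain $1$, and unbalanced otherwise; this does not depend on $\tilde V_0$. An unbalanced map graph in $G_0$ is a subgraph of $G_0$ in which every connected component contains exactly one cycle, each of these cycles being unbalanced. **Frameworks.** For a finite dimensional real normed space $(X,\|\cdot\|)$, a bar-joint framework is a pair $(G,p)$ with $p=(p_v)\in X^{|V|}$ and $p_v\neq p_w$ for $vw\in E$. It is well-positioned if the rigidity map $f_G:X^{|V|}\to\mathbb{R}^{|E|}$,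 $f_G(x)=(\|x_v-x_w\|)_{vw\in E}$, is differentiable at $p$. An infinitesimal flex is $u\in X^{|V|}$ whose directional derivative $D_uf_G(p)=\lim_{t\to0}\frac1t(f_G(p+tu)-f_G(p))$ is $0$. A rigid motion of $X$ is a family of continuous paths $\{\alpha_x:[-1,1]\to X\}_{x\in X}$, each differentiable at $0$, with $\alpha_x(0)=x$ and $\|\alpha_x(t)-\alpha_y(t)\|=\|x-y\|$ for all $x,y,t$; a flex is trivial if it equals $(\alpha_{p_v}'(0))_{v\in V}$ for some rigid motion. $\mathrm{Isom}(X,\|\cdot\|)$ is the group of linear isometries. $(G,p)$ is $\mathbb{Z}_2$-symmetric with respect to $\theta$ and a representation $\tau:\mathbb{Z}_2\to\mathrm{Isom}(X,\|\cdot\|)$ if $\tau(-1)p_v=p_{-v}$ for all $v$. A flex $u$ is anti-symmetric if $u_{-v}=-\tau(-1)u_v$ for all $v\in V$. $(G,p)$ is anti-symmetrically infinitesimally rigid if every anti-symmetric infinitesimal flex is trivial, and anti-symmetrically isostatic if in addition no $\mathbb{Z}_2$-symmetric proper spanning subframework (i.e. $(H,p)$ with $H\neq G$ a $\theta$-invariant spanning subgraph) is anti-symmetrically infinitesimally rigid. If $X=Z\oplus W$ with $\dim W=1$, a linear isometry $T$ is a reflection in the mirror $Z$ along $W$ if $T=I-2P$, where $P$ is the projection with range $W$ and kernel $Z$. **Quadrilateral norms.** Write $\mathcal{P}=\bigcap_{j=1,2}\{x\in\mathbb{R}^2:|x\cdot\hat F_j|\le1\}$, so $\|x\|_{\mathcal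 P}=\max_{j}|\hat F_j\cdot x|$, where $F_j=\{x\in\mathcal{P}:\hat F_j\cdot x=1\}$; put $\varphi_{F_j}(x)=\hat F_j\cdot x$. An edge $vw\in E$ has framework colour $[F]$ if $p_v-p_w$ lies in the cone of $F$ or $-F$; in a well-positioned framework each edge has exactly one colour. If $(G,p)$ is well-positioned and $\mathbb{Z}_2$-symmetric with respect to $\theta$ and $\tau$, where $\tau(-1)$ is a reflection in the mirror $\ker\varphi_{F_1}$ along $\ker\varphi_{F_2}$, then $e$ and $-e$ have the same colour for every $e\in E$, called the colour of $[e]$. $G_{F,0}$ is the monochrome subgraph of $G_0$ spanned by the edges $[e]$ of colour $[F]$. "Spanning in $G_0$" means having vertex set $V_0$. *)

theory Defs
  imports "HOL-Analysis.Analysis" "HOL-Algebra.Group"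
begin

section \<open>Symmetric graphs\<close>

text \<open>A finite simple graph has the finite type \<open>'v\<close> as its vertex set, and its edges are
  two-element sets of vertices. All spanning subgraphs of it live on the same vertex type.\<close>

definition simple_graph :: "'v::finite set set \<Rightarrow> bool" where
  "simple_graph E \<longleftrightarrow> (\<forall>e\<in>E. \<exists>v w. v \<noteq> w \<and> e = {v, w})"

definition Z2 :: "int monoid" where
  "Z2 = \<lparr>carrier = {1, -1}, mult = (*), one = 1\<rparr>"

definition graph_aut :: "'v set set \<Rightarrow> ('v \<Rightarrow> 'v) monoid" where
  "graph_aut E =
     \<lparr>carrier = {f. bij f \<and> (\<forall>v w. {f v, f w} \<in> E \<longleftrightarrow> {v, w} \<in> E)}, mult = (\<circ>), one = id\<rparr>"

definition Z2_symmetric_graph :: "(int \<Rightarrow> 'v::finite \<Rightarrow> 'v) \<Rightarrow> 'v set set \<Rightarrow> bool" where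
  "Z2_symmetric_graph \<theta> E \<longleftrightarrow> simple_graph E \<and> \<theta> \<in> hom Z2 (graph_aut E)"

definition acts_freely :: "(int \<Rightarrow> 'v \<Rightarrow> 'v) \<Rightarrow> bool" where
  "acts_freely \<theta> \<longleftrightarrow> (\<forall>v. v \<noteq> \<theta> (-1) v)"

definition vorbit :: "(int \<Rightarrow> 'v \<Rightarrow> 'v) \<Rightarrow> 'v \<Rightarrow> 'v set" where
  "vorbit \<theta> v = {v, \<theta> (-1) v}"

definition eorbit :: "(int \<Rightarrow> 'v \<Rightarrow> 'v) \<Rightarrow> 'v set \<Rightarrow> 'v set set" where
  "eorbit \<theta> e = {e, \<theta> (-1) ` e}"


section \<open>Undirected multigraphs with loops\<close>

text \<open>\<open>mends G e\<close> is the set of vertices incident to the edge \<open>e\<close>; it is a singleton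
  precisely if \<open>e\<close> is a loop.\<close>

record ('a, 'b) multigraph =
  mverts :: "'a set"
  medges :: "'b set"
  mends :: "'b \<Rightarrow> 'a set"

definition edge_subgraph :: "('a, 'b) multigraph \<Rightarrow> 'b set \<Rightarrow> ('a, 'b) multigraph" where
  "edge_subgraph G D = \<lparr>mverts = \<Union> (mends G ` D), medges = D, mends = mends G\<rparr>"

definition spanning_in :: "('a, 'b) multigraph \<Rightarrow> ('a, 'b) multigraph \<Rightarrow> bool" where
  "spanning_in H G \<longleftrightarrow> mverts H = mverts G"

definition reach :: "('a, 'b) multigraph \<Rightarrow> 'a \<Rightarrow> 'a \<Rightarrow> bool" where
  "reach G = (\<lambda>a b. \<exists>e\<in>medges G. mends G e = {a, b})\<^sup>*\<^sup>*"

definition connected_graph :: "('a, 'b) multigraph \<Rightarrow> bool" where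
  "connected_graph G \<longleftrightarrow> mverts G \<noteq> {} \<and> (\<forall>a\<in>mverts G. \<forall>b\<in>mverts G. reach G a b)"

definition component_of :: "('a, 'b) multigraph \<Rightarrow> 'a \<Rightarrow> ('a, 'b) multigraph" where
  "component_of G a =
     \<lparr>mverts = {b \<in> mverts G. reach G a b},
      medges = {e \<in> medges G. mends G e \<subseteq> {b \<in> mverts G. reach G a b}},
      mends = mends G\<rparr>"

text \<open>A cycle is identified with its edge set. Length 1 gives the loops (\<open>mends G e = {v, v}\<close>) and
  length 2 the pairs of parallel edges, because the edges of a cycle are distinct.\<close>

definition is_cycle :: "('a, 'b) multigraph \<Rightarrow> 'b set \<Rightarrow> bool" where
  "is_cycle G C \<longleftrightarrow>
     (\<exists>vs es. length vs = length es \<and> es \<noteq> [] \<and> distinct vs \<and> distinct es \<and>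
        set vs \<subseteq> mverts G \<and> set es \<subseteq> medges G \<and> set es = C \<and>
        (\<forall>i < length es. mends G (es ! i) = {vs ! i, vs ! (Suc i mod length vs)}))"

definition is_tree :: "('a, 'b) multigraph \<Rightarrow> bool" where
  "is_tree G \<longleftrightarrow> connected_graph G \<and> (\<nexists>C. is_cycle G C)"

definition cycle_gain :: "('b \<Rightarrow> int) \<Rightarrow> 'b set \<Rightarrow> int" where
  "cycle_gain \<psi> C = (\<Prod>e\<in>C. \<psi> e)"

definition balanced :: "('a, 'b) multigraph \<Rightarrow> ('b \<Rightarrow> int) \<Rightarrow> 'b set \<Rightarrow> bool" where
  "balanced G \<psi> D \<longleftrightarrow> (\<forall>C. is_cycle G C \<and> C \<subseteq> D \<longrightarrow> cycle_gain \<psi> C = 1)"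

definition unbalanced_map_graph :: "('a, 'b) multigraph \<Rightarrow> ('b \<Rightarrow> int) \<Rightarrow> bool" where
  "unbalanced_map_graph G \<psi> \<longleftrightarrow>
     (\<forall>a\<in>mverts G. (\<exists>!C. is_cycle (component_of G a) C) \<and>
        (\<forall>C. is_cycle (component_of G a) C \<longrightarrow> \<not> balanced G \<psi> C))"


section \<open>The quotient gain graph\<close>

definition quotient_graph ::
    "(int \<Rightarrow> 'v \<Rightarrow> 'v) \<Rightarrow> 'v set set \<Rightarrow> ('v set, 'v set set) multigraph" where
  "quotient_graph \<theta> E =
     \<lparr>mverts = range (vorbit \<theta>),
      medges = eorbit \<theta> ` E,
      mends = (\<lambda>X. {A \<in> range (vorbit \<theta>). \<exists>e\<in>X. \<exists>v\<in>A. v \<in> e})\<rparr>"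

definition vertex_orbit_representatives :: "(int \<Rightarrow> 'v \<Rightarrow> 'v) \<Rightarrow> 'v set \<Rightarrow> bool" where
  "vertex_orbit_representatives \<theta> R \<longleftrightarrow> (\<forall>A \<in> range (vorbit \<theta>). \<exists>!v. v \<in> R \<and> v \<in> A)"

definition gain :: "'v set \<Rightarrow> 'v set set \<Rightarrow> int" where
  "gain R X = (if \<exists>e\<in>X. e \<subseteq> R then 1 else -1)"


section \<open>Frameworks in finite dimensional normed spaces\<close>

definition is_norm :: "('x::real_vector \<Rightarrow> real) \<Rightarrow> bool" where
  "is_norm nrm \<longleftrightarrow>
     (\<forall>x. nrm x \<ge> 0) \<and> (\<forall>x. nrm x = 0 \<longleftrightarrow> x = 0) \<and>
     (\<forall>c x. nrm (c *\<^sub>R x) = \<bar>c\<bar> * nrm x) \<and> (\<forall>x y. nrm (x + y) \<le> nrm x + nrm y)"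

definition linear_isom :: "('x::real_vector \<Rightarrow> real) \<Rightarrow> ('x \<Rightarrow> 'x) monoid" where
  "linear_isom nrm =
     \<lparr>carrier = {T. linear T \<and> bij T \<and> (\<forall>x. nrm (T x) = nrm x)}, mult = (\<circ>), one = id\<rparr>"

definition framework :: "'v::finite set set \<Rightarrow> 'x ^ 'v \<Rightarrow> bool" where
  "framework E p \<longleftrightarrow> (\<forall>v w. {v, w} \<in> E \<longrightarrow> p $ v \<noteq> p $ w)"

definition edge_length ::
    "('x::euclidean_space \<Rightarrow> real) \<Rightarrow> 'x ^ 'v::finite \<Rightarrow> 'v set \<Rightarrow> real" where
  "edge_length nrm x e = (THE l. \<exists>v w. e = {v, w} \<and> v \<noteq> w \<and> l = nrm (x $ v - x $ w))"

text \<open>The coordinates of the rigidity map that do not belong to edges are constantly zero.\<close>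

definition rigidity_map ::
    "('x::euclidean_space \<Rightarrow> real) \<Rightarrow> 'v::finite set set \<Rightarrow> 'x ^ 'v \<Rightarrow> real ^ 'v set" where
  "rigidity_map nrm E x = (\<chi> e. if e \<in> E then edge_length nrm x e else 0)"

definition well_positioned ::
    "('x::euclidean_space \<Rightarrow> real) \<Rightarrow> 'v::finite set set \<Rightarrow> 'x ^ 'v \<Rightarrow> bool" where
  "well_positioned nrm E p \<longleftrightarrow> rigidity_map nrm E differentiable (at p)"

definition infinitesimal_flex ::
    "('x::euclidean_space \<Rightarrow> real) \<Rightarrow> 'v::finite set set \<Rightarrow> 'x ^ 'v \<Rightarrow> 'x ^ 'v \<Rightarrow> bool" where
  "infinitesimal_flex nrm E p u \<longleftrightarrow>
     ((\<lambda>t::real. (1 / t) *\<^sub>R (rigidity_map nrm E (p + t *\<^sub>R u) - rigidity_map nrm E p))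
        \<longlongrightarrow> 0) (at 0)"

definition rigid_motion ::
    "('x::euclidean_space \<Rightarrow> real) \<Rightarrow> ('x \<Rightarrow> real \<Rightarrow> 'x) \<Rightarrow> bool" where
  "rigid_motion nrm \<alpha> \<longleftrightarrow>
     (\<forall>x. continuous_on {-1..1} (\<alpha> x) \<and> \<alpha> x differentiable (at 0) \<and> \<alpha> x 0 = x) \<and>
     (\<forall>x y. \<forall>t\<in>{-1..1}. nrm (\<alpha> x t - \<alpha> y t) = nrm (x - y))"

definition trivial_flex ::
    "('x::euclidean_space \<Rightarrow> real) \<Rightarrow> 'x ^ 'v::finite \<Rightarrow> 'x ^ 'v \<Rightarrow> bool" where
  "trivial_flex nrm p u \<longleftrightarrow>
     (\<exists>\<alpha>. rigid_motion nrm \<alpha> \<and> u = (\<chi> v. vector_derivative (\<alpha> (p $ v)) (at 0)))"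

definition Z2_symmetric_framework ::
    "('x::euclidean_space \<Rightarrow> real) \<Rightarrow> 'v::finite set set \<Rightarrow> (int \<Rightarrow> 'v \<Rightarrow> 'v) \<Rightarrow>
      (int \<Rightarrow> 'x \<Rightarrow> 'x) \<Rightarrow> 'x ^ 'v \<Rightarrow> bool" where
  "Z2_symmetric_framework nrm E \<theta> \<tau> p \<longleftrightarrow>
     framework E p \<and> Z2_symmetric_graph \<theta> E \<and> \<tau> \<in> hom Z2 (linear_isom nrm) \<and>
     (\<forall>v. \<tau> (-1) (p $ v) = p $ \<theta> (-1) v)"

definition antisymmetric ::
    "(int \<Rightarrow> 'v::finite \<Rightarrow> 'v) \<Rightarrow> (int \<Rightarrow> 'x::real_vector \<Rightarrow> 'x) \<Rightarrow> 'x ^ 'v \<Rightarrow> bool" where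
  "antisymmetric \<theta> \<tau> u \<longleftrightarrow> (\<forall>v. u $ \<theta> (-1) v = - \<tau> (-1) (u $ v))"

definition antisymmetrically_rigid ::
    "('x::euclidean_space \<Rightarrow> real) \<Rightarrow> 'v::finite set set \<Rightarrow> (int \<Rightarrow> 'v \<Rightarrow> 'v) \<Rightarrow>
      (int \<Rightarrow> 'x \<Rightarrow> 'x) \<Rightarrow> 'x ^ 'v \<Rightarrow> bool" where
  "antisymmetrically_rigid nrm E \<theta> \<tau> p \<longleftrightarrow>
     (\<forall>u. infinitesimal_flex nrm E p u \<and> antisymmetric \<theta> \<tau> u \<longrightarrow> trivial_flex nrm p u)"

definition antisymmetrically_isostatic ::
    "('x::euclidean_space \<Rightarrow> real) \<Rightarrow> 'v::finite set set \<Rightarrow> (int \<Rightarrow> 'v \<Rightarrow> 'v) \<Rightarrow>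
      (int \<Rightarrow> 'x \<Rightarrow> 'x) \<Rightarrow> 'x ^ 'v \<Rightarrow> bool" where
  "antisymmetrically_isostatic nrm E \<theta> \<tau> p \<longleftrightarrow>
     antisymmetrically_rigid nrm E \<theta> \<tau> p \<and>
     (\<forall>H. H \<subset> E \<and> (\<forall>s\<in>carrier Z2. \<forall>e\<in>H. \<theta> s ` e \<in> H) \<longrightarrow>
        \<not> antisymmetrically_rigid nrm H \<theta> \<tau> p)"

text \<open>The space is the direct sum of kernel and range of any linear projection, so this
  decomposition into \<open>Z\<close> and \<open>W\<close> is not required separately.\<close>

definition is_reflection :: "('x::euclidean_space \<Rightarrow> 'x) \<Rightarrow> 'x set \<Rightarrow> 'x set \<Rightarrow> bool" where
  "is_reflection T Z W \<longleftrightarrow>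
     dim W = 1 \<and>
     (\<exists>P. linear P \<and> P \<circ> P = P \<and> range P = W \<and> {x. P x = 0} = Z \<and> (\<forall>x. T x = x - 2 *\<^sub>R P x))"


section \<open>Quadrilateral norms and framework colours\<close>

definition quadrilateral :: "real ^ 2 \<Rightarrow> real ^ 2 \<Rightarrow> (real ^ 2) set" where
  "quadrilateral f1 f2 = {x. \<bar>x \<bullet> f1\<bar> \<le> 1} \<inter> {x. \<bar>x \<bullet> f2\<bar> \<le> 1}"

text \<open>Linear independence of \<open>f1\<close> and \<open>f2\<close> is implied: otherwise the set on the right-hand side
  contains a line, which the unit ball of a norm does not.\<close>

definition quadrilateral_norm :: "(real ^ 2 \<Rightarrow> real) \<Rightarrow> real ^ 2 \<Rightarrow> real ^ 2 \<Rightarrow> bool" where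
  "quadrilateral_norm nrm f1 f2 \<longleftrightarrow> is_norm nrm \<and> {x. nrm x \<le> 1} = quadrilateral f1 f2"

definition facet :: "(real ^ 2) set \<Rightarrow> real ^ 2 \<Rightarrow> (real ^ 2) set" where
  "facet P f = {x \<in> P. x \<bullet> f = 1}"

definition phi :: "real ^ 2 \<Rightarrow> real ^ 2 \<Rightarrow> real" where
  "phi f x = f \<bullet> x"

definition has_colour :: "(real ^ 2) ^ 'v::finite \<Rightarrow> (real ^ 2) set \<Rightarrow> 'v set \<Rightarrow> bool" where
  "has_colour p F e \<longleftrightarrow>
     (\<exists>v w. e = {v, w} \<and> v \<noteq> w \<and> p $ v - p $ w \<in> cone hull F \<union> cone hull (uminus ` F))"

definition monochrome_quotient ::
    "(int \<Rightarrow> 'v::finite \<Rightarrow> 'v) \<Rightarrow> 'v set set \<Rightarrow> (real ^ 2) ^ 'v \<Rightarrow> (real ^ 2) set \<Rightarrow>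
      ('v set, 'v set set) multigraph" where
  "monochrome_quotient \<theta> E p F =
     edge_subgraph (quotient_graph \<theta> E) (eorbit \<theta> ` {e \<in> E. has_colour p F e})"


section \<open>Basic facts\<close>

lemma is_norm_minus:
  assumes "is_norm nrm"
  shows "nrm (- x) = nrm x"
proof -
  have "nrm ((-1) *\<^sub>R x) = \<bar>-1\<bar> * nrm x"
    using assms unfolding is_norm_def by blast
  then show ?thesis by simp
qed

lemma edge_length_doubleton:
  fixes x :: "'x::euclidean_space ^ 'v::finite"
  assumes "is_norm nrm" and "v \<noteq> w"
  shows "edge_length nrm x {v, w} = nrm (x $ v - x $ w)"
proof -
  have "nrm (x $ w - x $ v) = nrm (x $ v - x $ w)"
    using is_norm_minus[OF assms(1), of "x $ v - x $ w"] by simp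
  then show ?thesis
    unfolding edge_length_def using assms(2) by (intro the_equality) (auto simp: doubleton_eq_iff)
qed

lemma quadrilateral_norm_eq_max:
  assumes "quadrilateral_norm nrm f1 f2"
  shows "nrm x = max \<bar>phi f1 x\<bar> \<bar>phi f2 x\<bar>"
proof -
  have hom: "nrm (c *\<^sub>R y) = \<bar>c\<bar> * nrm y" and nn: "nrm y \<ge> 0" for c y
    using assms unfolding quadrilateral_norm_def is_norm_def by blast+
  have ball: "nrm y \<le> 1 \<longleftrightarrow> max \<bar>phi f1 y\<bar> \<bar>phi f2 y\<bar> \<le> 1" for y
    using assms unfolding quadrilateral_norm_def quadrilateral_def phi_def
    by (auto simp: inner_commute set_eq_iff)
  have le: "nrm x \<le> c \<longleftrightarrow> max \<bar>phi f1 x\<bar> \<bar>phi f2 x\<bar> \<le> c" if "c > 0" for c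
    using ball[of "(1 / c) *\<^sub>R x"] that
    by (simp add: hom phi_def abs_mult divide_le_eq)
  show ?thesis
  proof (rule antisym)
    show "nrm x \<le> max \<bar>phi f1 x\<bar> \<bar>phi f2 x\<bar>"
      by (rule field_le_epsilon) (subst le, auto)
    show "max \<bar>phi f1 x\<bar> \<bar>phi f2 x\<bar> \<le> nrm x"
      by (rule field_le_epsilon) (subst le[symmetric], use nn[of x] in auto)
  qed
qed

end

theory Submission
  imports Defs
begin

text \<open>
  In the coordinates \<open>phi f1\<close> and \<open>phi f2\<close> the norm is the maximum norm. The length of an edge is
  locally the modulus of one coordinate of the edge vector, and the colour of the edge says
  which one; so an infinitesimal flex is a velocity field whose first coordinate agrees at the
  ends of every edge of the first colour and whose second coordinate agrees at the ends of every
  edge of the second colour (\<open>infinitesimal_flex_iff\<close>). The trivial flexes are the translations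
  (\<open>trivial_flex_iff_translation\<close>).

  The reflection negates the first coordinate and preserves the second one. Anti-symmetry of a
  flex therefore means that its first coordinate is a function on vertex orbits, and that its
  second coordinate changes sign under the action. Fixing representatives, the second coordinate
  also becomes a function on vertex orbits, and the condition at an edge acquires the gain of
  the edge as a factor. In this way rigidity separates into two independent conditions on the
  quotient graph (\<open>antisymmetrically_rigid_iff\<close>): functions that agree along the edges of the
  first colour are constant, and functions that satisfy the gain conditions along the edges of
  the second colour are zero. The first condition is connectivity, the second one says that
  every component is unbalanced.

  Both conditions are monotone in the edge set, so a framework is isostatic exactly if each colour
  class is minimal with respect to deletion of one edge orbit
  (\<open>antisymmetrically_isostatic_iff\<close>). The minimal connecting edge sets on at least two vertices
  are the spanning trees (\<open>is_tree_iff_minimally_connects\<close>), and the minimal edge sets all of whose components are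
  unbalanced are the spanning unbalanced map graphs
  (\<open>unbalanced_map_graph_iff_minimally_forces_zero\<close>). The combinatorial input for both is that a
  component on which all potentials vanish contains a circuit of gain \<open>-1\<close>
  (\<open>unbalanced_circuit_if_potentials_vanish\<close>). A single vertex orbit cannot occur on either side
  of the equivalence: all its edges would be fixed, hence of the first colour, and nothing would
  force the second coordinate to vanish (\<open>two_vertex_orbits\<close>).
\<close>

section \<open>Circuits and potentials in gain graphs\<close>

text \<open>
  The part of \<open>is_cycle\<close> that depends on the incidence map only. It lets a cycle be moved freely
  between a graph, its components and its edge-deleted subgraphs.
\<close>

definition circuit :: "('b \<Rightarrow> 'a set) \<Rightarrow> 'b set \<Rightarrow> bool" where
  "circuit ends C \<longleftrightarrow>
     (\<exists>vs es. length vs = length es \<and> es \<noteq> [] \<and> distinct vs \<and> distinct es \<and> set es = C \<and>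
        (\<forall>i < length es. ends (es ! i) = {vs ! i, vs ! (Suc i mod length vs)}))"

definition linked :: "('b \<Rightarrow> 'a set) \<Rightarrow> 'b set \<Rightarrow> 'a \<Rightarrow> 'a \<Rightarrow> bool" where
  "linked ends D = (\<lambda>x y. \<exists>e\<in>D. ends e = {x, y})\<^sup>*\<^sup>*"

text \<open>
  The switching functions of a gain graph. For gains in \<open>{1, -1}\<close> the condition at an edge does
  not depend on the order in which its ends are read, and at a loop of gain \<open>-1\<close> it forces the
  value \<open>0\<close>.
\<close>

definition potential :: "('b \<Rightarrow> 'a set) \<Rightarrow> ('b \<Rightarrow> int) \<Rightarrow> 'b set \<Rightarrow> ('a \<Rightarrow> real) \<Rightarrow> bool" where
  "potential ends \<psi> D c \<longleftrightarrow>
     (\<forall>e\<in>D. \<forall>x y. ends e = {x, y} \<longrightarrow> c x = of_int (\<psi> e) * c y)"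

lemma reach_eq_linked: "reach G = linked (mends G) (medges G)"
  by (simp add: reach_def linked_def)

lemma linked_refl [simp]: "linked ends D x x"
  by (simp add: linked_def)

lemma linked_edge: "e \<in> D \<Longrightarrow> ends e = {x, y} \<Longrightarrow> linked ends D x y"
  unfolding linked_def by blast

lemma linked_trans: "linked ends D x y \<Longrightarrow> linked ends D y z \<Longrightarrow> linked ends D x z"
  unfolding linked_def by simp

lemma linked_sym: "linked ends D x y \<Longrightarrow> linked ends D y x"
proof -
  have "symp (\<lambda>x y. \<exists>e\<in>D. ends e = {x, y})"
    by (auto intro!: sympI simp: insert_commute)
  then show "linked ends D x y \<Longrightarrow> linked ends D y x"
    unfolding linked_def by (meson sympD symp_rtranclp)
qed

lemma linked_mono: "linked ends D x y \<Longrightarrow> D \<subseteq> D' \<Longrightarrow> linked ends D' x y"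
  unfolding linked_def by (erule rtranclp_mono[THEN predicate2D, rotated]) blast

lemma potential_mono: "potential ends \<psi> D' c \<Longrightarrow> D \<subseteq> D' \<Longrightarrow> potential ends \<psi> D c"
  unfolding potential_def by blast

lemma potential_linked:
  assumes "potential ends (\<lambda>_. 1) D c" "linked ends D x y"
  shows "c x = c y"
  using assms(2) unfolding linked_def
  by (induction rule: rtranclp_induct) (use assms(1) in \<open>auto simp: potential_def\<close>)

lemma potential_vanishes_linked:
  assumes "potential ends \<psi> D c" "linked ends D x y" "c x = 0"
  shows "c y = 0"
  using assms(2) unfolding linked_def
proof (induction rule: rtranclp_induct)
  case (step y z)
  then obtain e where "e \<in> D" "ends e = {z, y}" by (auto simp: insert_commute)
  then have "c z = of_int (\<psi> e) * c y" using assms(1) unfolding potential_def by blast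
  then show ?case using step by simp
qed (use assms in simp)

lemma potential_indicator_linked:
  "potential ends (\<lambda>_. 1) D (\<lambda>y. if linked ends D x y then 1 else 0)"
  unfolding potential_def
  by (auto dest: linked_edge linked_sym intro: linked_trans)

lemma is_cycle_iff_circuit:
  assumes "\<And>e. e \<in> medges G \<Longrightarrow> mends G e \<subseteq> mverts G"
  shows "is_cycle G C \<longleftrightarrow> circuit (mends G) C \<and> C \<subseteq> medges G"
proof -
  have "set vs \<subseteq> mverts G"
    if "length vs = length es" "set es \<subseteq> medges G"
      "\<forall>i < length es. mends G (es ! i) = {vs ! i, vs ! (Suc i mod length vs)}" for vs es
  proof
    fix v assume "v \<in> set vs"
    then obtain i where "i < length vs" "v = vs ! i" by (auto simp: in_set_conv_nth)
    then have i: "i < length es" "v = vs ! i" using that(1) by simp_all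
    then have "mends G (es ! i) \<subseteq> mverts G" 
      by (intro assms) (meson i(1) that(2) nth_mem subsetD)
    then show "v \<in> mverts G" using i that(3) by auto
  qed
  note vs = this
  show ?thesis
  proof
    assume "is_cycle G C"
    then show "circuit (mends G) C \<and> C \<subseteq> medges G"
      unfolding is_cycle_def circuit_def by blast
  next
    assume *: "circuit (mends G) C \<and> C \<subseteq> medges G"
    then obtain ws es where "length ws = length es" "es \<noteq> []" "distinct ws" "distinct es" "set es = C"
      "\<forall>i < length es. mends G (es ! i) = {ws ! i, ws ! (Suc i mod length ws)}"
      unfolding circuit_def by blast
    moreover from this have "set ws \<subseteq> mverts G" using * by (intro vs) auto
    ultimately show "is_cycle G C" unfolding is_cycle_def using * by blast
  qed
qed

lemma is_cycle_component_iff: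
  assumes "\<And>e. e \<in> medges G \<Longrightarrow> mends G e \<subseteq> mverts G"
  shows "is_cycle (component_of G a) C \<longleftrightarrow>
    circuit (mends G) C \<and> C \<subseteq> medges G \<and>
    (\<forall>e\<in>C. \<forall>x\<in>mends G e. linked (mends G) (medges G) a x)"
  by (subst is_cycle_iff_circuit)
    (use assms in \<open>auto simp: component_of_def reach_eq_linked subset_eq\<close>)

lemma circuit_nonempty: "circuit ends C \<Longrightarrow> C \<noteq> {}"
  unfolding circuit_def by auto

lemma circuit_ends:
  assumes "circuit ends C" "e \<in> C" obtains x y where "ends e = {x, y}"
proof -
  obtain vs es where *: "set es = C" "\<forall>i < length es. ends (es ! i) = {vs ! i, vs ! (Suc i mod length vs)}"
    using assms(1) unfolding circuit_def by blast
  obtain i where "i < length es" "es ! i = e" using assms(2) *(1) by (auto simp: in_set_conv_nth)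
  then show thesis using that *(2) by blast
qed

lemma circuit_start_at:
  assumes "circuit ends C" and "e \<in> C"
  obtains vs es where "length vs = length es" "es \<noteq> []" "distinct vs" "distinct es" "set es = C"
    "\<And>i. i < length es \<Longrightarrow> ends (es ! i) = {vs ! i, vs ! (Suc i mod length vs)}" "es ! 0 = e"
proof -
  from assms(1) obtain vs es where *: "length vs = length es" "es \<noteq> []" "distinct vs" "distinct es"
    "set es = C" "\<And>i. i < length es \<Longrightarrow> ends (es ! i) = {vs ! i, vs ! (Suc i mod length vs)}"
    unfolding circuit_def by blast
  obtain k where k: "k < length es" "es ! k = e"
    using assms(2) *(5) by (auto simp: in_set_conv_nth)
  show thesis
  proof (rule that[of "rotate k vs" "rotate k es"])
    show "rotate k es ! 0 = e" using k *(2) by (simp add: nth_rotate)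
    fix i assume "i < length (rotate k es)"
    then have i: "i < length es" by simp
    have n: "length es > 0" using *(2) by simp
    have "(k + Suc i mod length es) mod length es = Suc ((k + i) mod length es) mod length es"
      by (simp add: mod_simps)
    then show "ends (rotate k es ! i) =
        {rotate k vs ! i, rotate k vs ! (Suc i mod length (rotate k vs))}"
      using *(6)[of "(k + i) mod length es"] i n *(1) by (simp add: nth_rotate)
  qed (use * in auto)
qed

lemma prod_signs:
  fixes \<psi> :: "'b \<Rightarrow> int"
  assumes "\<And>e. \<psi> e = 1 \<or> \<psi> e = -1"
  shows "prod \<psi> A = 1 \<or> prod \<psi> A = -1"
proof (induction A rule: infinite_finite_induct)
  case (insert e A)
  then show ?case using assms[of e] by auto
qed auto

text \<open>
  Walking from one end of \<open>e\<close> to the other along the rest of the circuit multiplies the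
  potential by the gains met on the way, which are the gain of the circuit divided by that of
  \<open>e\<close>; and division by a sign is multiplication. If the circuit has gain \<open>1\<close>, this is the
  condition at \<open>e\<close>; otherwise it is its negative.
\<close>

lemma potential_around_circuit:
  assumes \<psi>: "\<And>e. \<psi> e = 1 \<or> \<psi> e = -1"
    and C: "circuit ends C" and e: "e \<in> C" "ends e = {x, y}"
    and c: "potential ends \<psi> (C - {e}) c"
  shows "c x = of_int (cycle_gain \<psi> C * \<psi> e) * c y"
proof -
  from C e(1) obtain vs es where *: "length vs = length es" "es \<noteq> []" "distinct vs" "distinct es"
    "set es = C" "\<And>i. i < length es \<Longrightarrow> ends (es ! i) = {vs ! i, vs ! (Suc i mod length vs)}"
    and e0: "es ! 0 = e"
    by (rule circuit_start_at) blast
  let ?n = "length es"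
  have n: "?n > 0" using *(2) by simp
  have sq: "of_int (\<psi> e') * of_int (\<psi> e') = (1::real)" for e' using \<psi>[of e'] by auto
  \<comment> \<open>The walk runs through the edges \<open>1, ..., m - 1\<close> of a circuit that starts with \<open>e\<close>; the index
    modulo the length closes it at the starting vertex, and also covers loops.\<close>
  have along: "c (vs ! (1 mod ?n)) = of_int (\<Prod>i=1..<m. \<psi> (es ! i)) * c (vs ! (m mod ?n))"
    if "1 \<le> m" "m \<le> ?n" for m
    using that
  proof (induction m rule: nat_induct_at_least)
    case base
    then show ?case by simp
  next
    case (Suc m)
    then have m: "m < ?n" by simp
    then have "es ! m \<noteq> e" using nth_eq_iff_index_eq[OF *(4) m n] Suc(1) e0 by auto
    then have "es ! m \<in> C - {e}" using *(5) m by auto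
    then have "c (vs ! m) = of_int (\<psi> (es ! m)) * c (vs ! (Suc m mod ?n))"
      using c *(6)[OF m] *(1) unfolding potential_def by auto
    then show ?case using Suc m by (simp add: prod.atLeastLessThan_Suc mult.assoc)
  qed
  have "cycle_gain \<psi> C = (\<Prod>i=0..<?n. \<psi> (es ! i))"
    unfolding cycle_gain_def *(5)[symmetric]
    by (rule prod.reindex_bij_betw[symmetric])
      (use bij_betw_nth[OF *(4) _ refl] in \<open>simp add: atLeast0LessThan\<close>)
  also have "\<dots> = \<psi> e * (\<Prod>i=1..<?n. \<psi> (es ! i))"
    using n e0 by (simp add: prod.atLeast_Suc_lessThan)
  finally have g: "cycle_gain \<psi> C = \<psi> e * (\<Prod>i=1..<?n. \<psi> (es ! i))" .
  define q where "q = (\<Prod>i=1..<?n. \<psi> (es ! i))"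
  have "q = 1 \<or> q = -1"
    unfolding q_def using \<psi> by (intro prod_signs)
  then have qq: "real_of_int q * of_int q = 1" by auto
  have ge: "real_of_int (cycle_gain \<psi> C * \<psi> e) = of_int q"
    unfolding g q_def[symmetric] using \<psi>[of e] by auto
  have 1: "c (vs ! (1 mod ?n)) = of_int q * c (vs ! 0)"
    using along[of ?n] n unfolding q_def by simp
  then have 2: "c (vs ! 0) = of_int q * c (vs ! (1 mod ?n))"
    using qq by (simp add: mult.assoc[symmetric])
  have "ends e = {vs ! 0, vs ! (1 mod ?n)}" using *(6)[OF n] e0 *(1) by simp
  then have "{x, y} = {vs ! 0, vs ! (1 mod ?n)}" using e(2) by simp
  then show ?thesis using 1 2 ge by (auto simp: doubleton_eq_iff)
qed

lemma potential_extends_over_balanced_circuit: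
  assumes \<psi>: "\<And>e. \<psi> e = 1 \<or> \<psi> e = -1"
    and C: "circuit ends C" "C \<subseteq> D" "e \<in> C" "cycle_gain \<psi> C = 1"
    and c: "potential ends \<psi> (D - {e}) c"
  shows "potential ends \<psi> D c"
proof -
  have "potential ends \<psi> (C - {e}) c" using c by (rule potential_mono) (use C in blast)
  then have "ends e = {x, y} \<Longrightarrow> c x = of_int (\<psi> e) * c y" for x y
    using potential_around_circuit[of \<psi>, OF \<psi> C(1,3)] C(4) by auto
  then show ?thesis using c unfolding potential_def by blast
qed

lemma potential_vanishes_on_unbalanced_circuit:
  assumes \<psi>: "\<And>e. \<psi> e = 1 \<or> \<psi> e = -1"
    and C: "circuit ends C" "cycle_gain \<psi> C \<noteq> 1"
    and c: "potential ends \<psi> C c" and e: "e \<in> C" "x \<in> ends e"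
  shows "c x = 0"
proof -
  obtain y where y: "ends e = {x, y}"
    using circuit_ends[OF C(1) e(1)] e(2) by (metis insert_iff insert_commute empty_iff)
  have "cycle_gain \<psi> C = 1 \<or> cycle_gain \<psi> C = -1"
    unfolding cycle_gain_def using \<psi> by (rule prod_signs)
  then have g: "cycle_gain \<psi> C = -1" using C(2) by simp
  have "c x = of_int (cycle_gain \<psi> C * \<psi> e) * c y"
    by (rule potential_around_circuit[of \<psi>, OF \<psi> C(1) e(1) y potential_mono[OF c]]) blast
  moreover have "c x = of_int (\<psi> e) * c y" using c e(1) y unfolding potential_def by blast
  ultimately show ?thesis using g by simp
qed

text \<open>
  For trivial gains every circuit is balanced, so the indicator of a component of \<open>D - {e}\<close>
  extends over \<open>e\<close> and is constant along \<open>D\<close>.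
\<close>

lemma linked_avoiding_circuit_edge:
  assumes "circuit ends C" "C \<subseteq> D" "e \<in> C" "linked ends D x y"
  shows "linked ends (D - {e}) x y"
proof -
  have "potential ends (\<lambda>_. 1) (D - {e}) (\<lambda>y. if linked ends (D - {e}) x y then 1 else 0)"
    by (rule potential_indicator_linked)
  then have "potential ends (\<lambda>_. 1) D (\<lambda>y. if linked ends (D - {e}) x y then 1 else 0)"
    by (rule potential_extends_over_balanced_circuit[rotated -1])
      (use assms in \<open>auto simp: cycle_gain_def\<close>)
  from potential_linked[OF this assms(4)] show ?thesis by (auto split: if_splits)
qed

text \<open>
  The existence result on which both graph characterisations rest. In the double cover, whose
  vertices are the pairs \<open>(x, s)\<close> of a vertex and a sign and in which an edge multiplies the sign
  by its gain, the indicator of the points reachable from \<open>(a, 1)\<close>, counted with sign, is a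
  potential. If it vanishes at \<open>a\<close>, then some walk leads from \<open>(a, 1)\<close> to \<open>(a, -1)\<close>. Among all
  walks from \<open>(z, s)\<close> to \<open>(z, -s)\<close> with \<open>z\<close> in the component of \<open>a\<close>, a shortest one projects to a
  circuit, and the change of sign along it is the gain of that circuit.
\<close>

lemma unbalanced_circuit_if_potentials_vanish:
  assumes \<psi>: "\<And>e. \<psi> e = 1 \<or> \<psi> e = -1"
    and vanish: "\<And>c. potential ends \<psi> D c \<Longrightarrow> c a = 0"
  obtains C where "circuit ends C" "C \<subseteq> D" "cycle_gain \<psi> C = -1"
    "\<And>e x. e \<in> C \<Longrightarrow> x \<in> ends e \<Longrightarrow> linked ends D a x"
proof -
  define S where "S = (\<lambda>(x, s) (y, t). \<exists>e\<in>D. ends e = {x, y} \<and> t = \<psi> e * s)"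
  have S_sym: "S (y, t) (x, s)" if "S (x, s) (y, t)" for x y s t
  proof -
    from that obtain e where "e \<in> D" "ends e = {x, y}" "t = \<psi> e * s" unfolding S_def by auto
    moreover from this have "s = \<psi> e * t" using \<psi>[of e] by auto
    ultimately show ?thesis unfolding S_def by (auto simp: insert_commute)
  qed
  have linked_walk: "linked ends D (fst X) (fst Y)" if "(S ^^ n) X Y" for n X Y
    using that
  proof (induction n arbitrary: Y)
    case (Suc n)
    then obtain Z where Z: "(S ^^ n) X Z" "S Z Y" by auto
    then have "linked ends D (fst Z) (fst Y)"
      unfolding S_def by (auto intro: linked_edge)
    then show ?case using Suc.IH[OF Z(1)] linked_trans by metis
  qed auto
  define c where "c = (\<lambda>y. (if S\<^sup>*\<^sup>* (a, 1) (y, 1) then 1 else 0)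
                         - (if S\<^sup>*\<^sup>* (a, 1) (y, -1) then (1::real) else 0))"
  have "potential ends \<psi> D c"
    unfolding potential_def
  proof (intro ballI allI impI)
    fix e x y assume e: "e \<in> D" "ends e = {x, y}"
    have st: "S (x, s) (y, \<psi> e * s)" for s unfolding S_def using e by auto
    have "S\<^sup>*\<^sup>* (a, 1) (x, s) \<longleftrightarrow> S\<^sup>*\<^sup>* (a, 1) (y, \<psi> e * s)" for s
      using st[of s] S_sym[OF st[of s]] by (meson rtranclp.rtrancl_into_rtrancl)
    from this[of 1] this[of "-1"] show "c x = of_int (\<psi> e) * c y"
      unfolding c_def using \<psi>[of e] by auto
  qed
  then have "c a = 0" by (rule vanish)
  then have "S\<^sup>*\<^sup>* (a, 1) (a, -1)" unfolding c_def by (auto split: if_splits)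
  then obtain m where "(S ^^ m) (a, 1) (a, -1)" by (auto simp: rtranclp_power)
  then have ex: "\<exists>n z s. linked ends D a z \<and> (s = 1 \<or> s = -1) \<and> (S ^^ n) (z, s) (z, -s)"
    by (intro exI[of _ m] exI[of _ a] exI[of _ 1]) auto
  define n where "n = (LEAST n. \<exists>z s. linked ends D a z \<and> (s = 1 \<or> s = -1) \<and> (S ^^ n) (z, s) (z, -s))"
  have "\<exists>z s. linked ends D a z \<and> (s = 1 \<or> s = -1) \<and> (S ^^ n) (z, s) (z, -s)"
    using ex unfolding n_def by (rule LeastI_ex)
  then obtain z s where z: "linked ends D a z" "s = 1 \<or> s = -1" "(S ^^ n) (z, s) (z, -s)" by blast
  have minimal: "n \<le> n'" if "linked ends D a z'" "s' = 1 \<or> s' = -1" "(S ^^ n') (z', s') (z', -s')"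
    for n' z' s' unfolding n_def using that by (intro Least_le) blast
  from z(3) obtain f where f: "f 0 = (z, s)" "f n = (z, -s)" "\<And>i. i < n \<Longrightarrow> S (f i) (f (Suc i))"
    unfolding relpowp_fun_conv by blast
  have sub: "(S ^^ (j - i)) (f i) (f j)" if "i \<le> j" "j \<le> n" for i j
    unfolding relpowp_fun_conv using that f(3) by (intro exI[of _ "\<lambda>k. f (i + k)"]) auto
  have linked_f: "linked ends D a (fst (f i))" if "i \<le> n" for i
    using linked_walk[OF sub[of 0 i]] that f(1) z(1) by (auto intro: linked_trans)
  have sign: "snd (f i) = 1 \<or> snd (f i) = -1" if "i \<le> n" for i
    using that
  proof (induction i)
    case (Suc i)
    then have "S (f i) (f (Suc i))" using f(3) by simp
    then obtain e where "snd (f (Suc i)) = \<psi> e * snd (f i)"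
      unfolding S_def case_prod_beta by blast
    then show ?case using Suc \<psi>[of e] by auto
  qed (use f z in auto)
  have n: "n > 0" using f(1,2) z(2) by (cases n) auto
  \<comment> \<open>A repeated vertex would shorten the walk: if the signs agree, cut out the part in between,
    and if they differ, keep only that part.\<close>
  have inj: "fst (f i) \<noteq> fst (f j)" if ij: "i < j" "j < n" for i j
  proof
    assume eq: "fst (f i) = fst (f j)"
    show False
    proof (cases "snd (f i) = snd (f j)")
      case True
      then have "f i = f j" using eq by (simp add: prod_eq_iff)
      then have "(S ^^ ((i - 0) + (n - j))) (f 0) (f n)"
        unfolding relpowp_add using sub[of 0 i] sub[of j n] ij by auto
      then have "(S ^^ (i + (n - j))) (z, s) (z, -s)" using f by simp
      from minimal[OF z(1,2) this] ij show False by simp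
    next
      case False
      then have "f j = (fst (f i), - snd (f i))"
        using eq sign[of i] sign[of j] ij by (auto simp: prod_eq_iff)
      then have "(S ^^ (j - i)) (fst (f i), snd (f i)) (fst (f i), - snd (f i))"
        using sub[of i j] ij by simp
      from minimal[OF linked_f sign this] ij show False by simp
    qed
  qed
  have "\<forall>i. \<exists>e. i < n \<longrightarrow> e \<in> D \<and> ends e = {fst (f i), fst (f (Suc i))} \<and>
      snd (f (Suc i)) = \<psi> e * snd (f i)"
    using f(3) unfolding S_def by (fastforce simp: case_prod_beta)
  then obtain g where g: "\<And>i. i < n \<Longrightarrow> g i \<in> D"
    "\<And>i. i < n \<Longrightarrow> ends (g i) = {fst (f i), fst (f (Suc i))}"
    "\<And>i. i < n \<Longrightarrow> snd (f (Suc i)) = \<psi> (g i) * snd (f i)" by metis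
  have closed: "fst (f (Suc i)) = fst (f (Suc i mod n))" if "i < n" for i
    using that f(1,2) by (cases "Suc i = n") auto
  \<comment> \<open>As the vertices are distinct, an edge can repeat only on a walk of length 2 that goes back
    along its first edge, and such a walk does not change the sign.\<close>
  have ginj: "g i \<noteq> g j" if ij: "i < j" "j < n" for i j
  proof
    assume eq: "g i = g j"
    then have "{fst (f i), fst (f (Suc i))} = {fst (f j), fst (f (Suc j))}"
      using g(2)[of i] g(2)[of j] ij by simp
    then have 1: "fst (f i) = fst (f (Suc j))" "fst (f (Suc i)) = fst (f j)"
      using inj[OF ij] by (auto simp: doubleton_eq_iff)
    have "Suc j = n"
      using 1(1) inj[of i "Suc j"] ij by (metis Suc_lessI less_Suc_eq)
    moreover have "i = 0"
      using 1(1) f inj[of 0 i] ij \<open>Suc j = n\<close> by force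
    moreover have "Suc i = j"
      using 1(2) inj[of "Suc i" j] ij by (metis Suc_lessI)
    ultimately have "snd (f n) = \<psi> (g j) * (\<psi> (g i) * snd (f 0))"
      using g(3)[of i] g(3)[of j] ij by auto
    then show False using eq \<psi>[of "g j"] f(1,2) z(2) by auto
  qed
  have dg: "inj_on g {0..<n}" by (rule linorder_inj_onI) (auto dest: ginj)
  have df: "inj_on (\<lambda>i. fst (f i)) {0..<n}" by (rule linorder_inj_onI) (auto dest: inj)
  have tele: "snd (f m) = (\<Prod>i=0..<m. \<psi> (g i)) * s" if "m \<le> n" for m
    using that by (induction m) (use f(1) g(3) in \<open>auto simp: mult_ac\<close>)
  show thesis
  proof (rule that[of "g ` {0..<n}"])
    show "circuit ends (g ` {0..<n})"
      unfolding circuit_def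
      by (rule exI[of _ "map (\<lambda>i. fst (f i)) [0..<n]"], rule exI[of _ "map g [0..<n]"])
        (use n dg df g(2) closed in \<open>auto simp: distinct_map\<close>)
    show "g ` {0..<n} \<subseteq> D" using g by auto
    have "cycle_gain \<psi> (g ` {0..<n}) = (\<Prod>i=0..<n. \<psi> (g i))"
      unfolding cycle_gain_def by (simp add: prod.reindex[OF dg])
    moreover have "(\<Prod>i=0..<n. \<psi> (g i)) * s = - s" using tele[of n] f(2) by simp
    ultimately show "cycle_gain \<psi> (g ` {0..<n}) = -1" using z(2) by auto
    show "linked ends D a x" if "e \<in> g ` {0..<n}" "x \<in> ends e" for e x
      using that g(2) linked_f by (auto simp: less_imp_le Suc_leI)
  qed
qed

text \<open>
  Closing a path by an edge, obtained from the previous lemma by giving \<open>e\<close> the gain \<open>-1\<close> and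
  all other edges the gain \<open>1\<close>: the detour around \<open>e\<close> makes every potential vanish at \<open>x\<close>, and a
  circuit of gain \<open>-1\<close> has to use \<open>e\<close>.
\<close>

lemma circuit_through_edge:
  assumes e: "e \<in> D" "ends e = {x, y}" and xy: "linked ends (D - {e}) x y"
  obtains C where "circuit ends C" "C \<subseteq> D" "e \<in> C"
    "\<And>e' z. e' \<in> C \<Longrightarrow> z \<in> ends e' \<Longrightarrow> linked ends D x z"
proof -
  define \<psi> :: "'a \<Rightarrow> int" where "\<psi> = (\<lambda>e'. if e' = e then -1 else 1)"
  have \<psi>: "\<psi> e' = 1 \<or> \<psi> e' = -1" for e' unfolding \<psi>_def by simp
  have "c x = 0" if c: "potential ends \<psi> D c" for c
  proof -
    have "potential ends (\<lambda>_. 1) (D - {e}) c" using c unfolding potential_def \<psi>_def by auto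
    from potential_linked[OF this xy] have "c x = c y" .
    moreover have "c x = - c y" using c e unfolding potential_def \<psi>_def by fastforce
    ultimately show ?thesis by simp
  qed
  then obtain C where C: "circuit ends C" "C \<subseteq> D" "cycle_gain \<psi> C = -1"
    "\<And>e x'. e \<in> C \<Longrightarrow> x' \<in> ends e \<Longrightarrow> linked ends D x x'"
    using unbalanced_circuit_if_potentials_vanish[of \<psi> ends D x] \<psi> by blast
  have "e \<in> C"
  proof (rule ccontr)
    assume "e \<notin> C"
    then have "cycle_gain \<psi> C = 1"
      unfolding cycle_gain_def \<psi>_def by (intro prod.neutral) auto
    then show False using C(3) by simp
  qed
  then show thesis using that C by blast
qed

section \<open>Trees and unbalanced map graphs as minimal edge sets\<close>

text \<open>
  An edge set is measured by its potentials on the vertex set \<open>U\<close>. Under trivial gains the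
  potentials are the functions that are constant on connected components, so the first condition
  is connectivity. Under signed gains a component carries a nonzero potential exactly if it is
  balanced, so the second condition says that every component is unbalanced. Both conditions
  are inherited by larger edge sets, and they are the ones that rigidity produces.
\<close>

definition connects :: "('b \<Rightarrow> 'a set) \<Rightarrow> 'a set \<Rightarrow> 'b set \<Rightarrow> bool" where
  "connects ends U D \<longleftrightarrow>
     (\<forall>c. potential ends (\<lambda>_. 1) D c \<longrightarrow> (\<forall>x\<in>U. \<forall>y\<in>U. c x = c y))"

definition forces_zero :: "('b \<Rightarrow> 'a set) \<Rightarrow> ('b \<Rightarrow> int) \<Rightarrow> 'a set \<Rightarrow> 'b set \<Rightarrow> bool" where
  "forces_zero ends \<psi> U D \<longleftrightarrow> (\<forall>c. potential ends \<psi> D c \<longrightarrow> (\<forall>x\<in>U. c x = 0))"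

lemma connects_mono: "connects ends U D \<Longrightarrow> D \<subseteq> D' \<Longrightarrow> connects ends U D'"
  unfolding connects_def using potential_mono by blast

lemma forces_zero_mono: "forces_zero ends \<psi> U D \<Longrightarrow> D \<subseteq> D' \<Longrightarrow> forces_zero ends \<psi> U D'"
  unfolding forces_zero_def using potential_mono by blast

text \<open>
  A superfluous edge lies on a circuit, because its ends remain linked without it; and any edge
  of a circuit is superfluous, because potentials extend over balanced circuits. The second
  vertex in \<open>U\<close> excludes the graph that consists of one isolated vertex, which has no edge to
  span that vertex.
\<close>

lemma is_tree_iff_minimally_connects:
  assumes pairs: "\<And>e. e \<in> medges G \<Longrightarrow> \<exists>x\<in>U. \<exists>y\<in>U. mends G e = {x, y}"
    and verts: "mverts G = \<Union> (mends G ` medges G)"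
    and two: "a \<in> U" "b \<in> U" "a \<noteq> b"
  shows "is_tree G \<and> mverts G = U \<longleftrightarrow>
    connects (mends G) U (medges G) \<and>
    (\<forall>e\<in>medges G. \<not> connects (mends G) U (medges G - {e}))"
proof -
  let ?connecting = "connects (mends G) U"
  let ?D = "medges G" and ?ends = "mends G"
  have cyc: "is_cycle G C \<longleftrightarrow> circuit ?ends C \<and> C \<subseteq> ?D" for C
    by (rule is_cycle_iff_circuit) (use verts in auto)
  have connecting_linked: "linked ?ends D x y" if "?connecting D" "x \<in> U" "y \<in> U" for D x y
  proof -
    have "(if linked ?ends D x x then 1 else 0) = (if linked ?ends D x y then 1 else (0::real))"
      using that potential_indicator_linked[of ?ends D x] unfolding connects_def by blast
    then show ?thesis by (auto split: if_splits)
  qed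
  show ?thesis
  proof
    assume *: "is_tree G \<and> mverts G = U"
    then have "linked ?ends ?D x y" if "x \<in> U" "y \<in> U" for x y
      using that unfolding is_tree_def connected_graph_def reach_eq_linked by blast
    then have "?connecting ?D" unfolding connects_def by (blast intro: potential_linked)
    moreover have "\<not> ?connecting (?D - {e})" if e: "e \<in> ?D" for e
    proof
      assume c: "?connecting (?D - {e})"
      obtain x y where xy: "x \<in> U" "y \<in> U" "?ends e = {x, y}" using pairs[OF e] by blast
      obtain C where "circuit ?ends C" "C \<subseteq> ?D"
        by (rule circuit_through_edge[OF e xy(3) connecting_linked[OF c xy(1,2)]])
      then show False using * cyc unfolding is_tree_def by blast
    qed
    ultimately show "?connecting ?D \<and> (\<forall>e\<in>?D. \<not> ?connecting (?D - {e}))" by blast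
  next
    assume *: "?connecting ?D \<and> (\<forall>e\<in>?D. \<not> ?connecting (?D - {e}))"
    have "x \<in> mverts G" if x: "x \<in> U" for x
    proof (rule ccontr)
      assume "x \<notin> mverts G"
      then have "potential ?ends (\<lambda>_. 1) ?D (\<lambda>y. if y = x then 1 else 0)"
        unfolding potential_def verts by auto
      then have const: "(if y = x then 1 else 0) = (if x = x then 1 else (0::real))" if "y \<in> U" for y
        using * x that unfolding connects_def by blast
      have "y = x" if "y \<in> U" for y using const[OF that] by (auto split: if_splits)
      then show False using two by blast
    qed
    moreover have "mverts G \<subseteq> U" using pairs unfolding verts by fastforce
    ultimately have U: "mverts G = U" by blast
    have "connected_graph G"
      unfolding connected_graph_def reach_eq_linked U using * two connecting_linked by blast
    moreover have False if C: "circuit ?ends C" "C \<subseteq> ?D" for C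
    proof -
      obtain e where e: "e \<in> C" using circuit_nonempty[OF C(1)] by blast
      have "potential ?ends (\<lambda>_. 1) ?D c" if "potential ?ends (\<lambda>_. 1) (?D - {e}) c" for c
        by (rule potential_extends_over_balanced_circuit[OF _ C e _ that])
          (auto simp: cycle_gain_def)
      then have "?connecting (?D - {e})" using * unfolding connects_def by blast
      then show False using * e C by blast
    qed
    ultimately show "is_tree G \<and> mverts G = U" unfolding is_tree_def cyc using U by blast
  qed
qed

text \<open>
  Suppose that \<open>e\<close> is superfluous in an unbalanced map graph. Then both its ends still lie in
  components with an unbalanced circuit; by uniqueness this is the same circuit, so the ends are
  linked without \<open>e\<close> and there is a second circuit through \<open>e\<close>. Conversely, in a minimal edge set
  no circuit is balanced, because an edge of a balanced circuit is superfluous; and if a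
  component contained two circuits, an edge on only one of them would be superfluous, because
  the other one makes all potentials vanish on the component.
\<close>

lemma unbalanced_map_graph_iff_minimally_forces_zero:
  assumes \<psi>: "\<And>e. \<psi> e = 1 \<or> \<psi> e = -1"
    and pairs: "\<And>e. e \<in> medges G \<Longrightarrow> \<exists>x\<in>U. \<exists>y\<in>U. mends G e = {x, y}"
    and verts: "mverts G = \<Union> (mends G ` medges G)"
  shows "unbalanced_map_graph G \<psi> \<and> mverts G = U \<longleftrightarrow>
    forces_zero (mends G) \<psi> U (medges G) \<and>
    (\<forall>e\<in>medges G. \<not> forces_zero (mends G) \<psi> U (medges G - {e}))"
proof -
  let ?vanishing = "forces_zero (mends G) \<psi> U"
  let ?D = "medges G" and ?ends = "mends G"
  have sub: "e \<in> ?D \<Longrightarrow> ?ends e \<subseteq> mverts G" for e using verts by auto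
  have cyc: "is_cycle G C \<longleftrightarrow> circuit ?ends C \<and> C \<subseteq> ?D" for C
    by (rule is_cycle_iff_circuit[OF sub])
  define inc where "inc = (\<lambda>C a. circuit ?ends C \<and> C \<subseteq> ?D \<and> (\<forall>e\<in>C. \<forall>x\<in>?ends e. linked ?ends ?D a x))"
  have comp: "is_cycle (component_of G a) C \<longleftrightarrow> inc C a" for a C
    unfolding inc_def by (rule is_cycle_component_iff[OF sub])
  have incD: "circuit ?ends C" "C \<subseteq> ?D" "e \<in> C \<Longrightarrow> x \<in> ?ends e \<Longrightarrow> linked ?ends ?D a x"
    if "inc C a" for C a e x using that unfolding inc_def by blast+
  have incI: "inc C a" if "circuit ?ends C" "C \<subseteq> ?D"
    "\<And>e x. e \<in> C \<Longrightarrow> x \<in> ?ends e \<Longrightarrow> linked ?ends ?D a x" for C a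
    using that unfolding inc_def by blast
  have circuit_of_vanishing: "\<exists>C. circuit ?ends C \<and> C \<subseteq> D \<and> cycle_gain \<psi> C = -1 \<and>
      (\<forall>e\<in>C. \<forall>x\<in>?ends e. linked ?ends D a x)" if "?vanishing D" "a \<in> U" for D a
  proof -
    have "c a = 0" if "potential ?ends \<psi> D c" for c
      using that \<open>?vanishing D\<close> \<open>a \<in> U\<close> unfolding forces_zero_def by blast
    then show ?thesis
      using unbalanced_circuit_if_potentials_vanish[of \<psi> ?ends D a] \<psi> by metis
  qed
  have point: "\<exists>x. x \<in> ?ends e" if "e \<in> ?D" for e using pairs[OF that] by blast
  show ?thesis
  proof
    assume *: "unbalanced_map_graph G \<psi> \<and> mverts G = U"
    then have all: "\<forall>a\<in>U. (\<exists>!C. inc C a) \<and> (\<forall>C. inc C a \<longrightarrow> \<not> balanced G \<psi> C)"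
      unfolding unbalanced_map_graph_def comp by simp
    then have ex: "\<exists>C. inc C a" if "a \<in> U" for a using that by blast
    have unique: "C = C'" if "a \<in> U" "inc C a" "inc C' a" for a C C' using that all by blast
    have unbal: "\<not> balanced G \<psi> C" if "inc C a" "a \<in> U" for C a
      using all that by blast
    have "?vanishing ?D"
      unfolding forces_zero_def
    proof (intro allI impI ballI)
      fix c a assume c: "potential ?ends \<psi> ?D c" and a: "a \<in> U"
      from ex[OF a] obtain C where C: "inc C a" by blast
      from unbal[OF C a] obtain C' where
        C': "circuit ?ends C'" "C' \<subseteq> C" "cycle_gain \<psi> C' \<noteq> 1"
        unfolding balanced_def cyc by blast
      have CD: "C \<subseteq> ?D" using incD[OF C] by blast
      obtain e where e: "e \<in> C'" using circuit_nonempty[OF C'(1)] by blast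
      then obtain x where x: "x \<in> ?ends e" using point CD C' by blast
      have "c x = 0"
        by (rule potential_vanishes_on_unbalanced_circuit[of \<psi>, OF \<psi> C'(1,3) potential_mono[OF c] e x])
          (use CD C' in blast)
      moreover have "linked ?ends ?D x a" using incD(3)[OF C _ x] C' e by (blast intro: linked_sym)
      ultimately show "c a = 0" using potential_vanishes_linked[OF c] by blast
    qed
    moreover have "\<not> ?vanishing (?D - {e})" if e: "e \<in> ?D" for e
    proof
      assume v: "?vanishing (?D - {e})"
      obtain x y where xy: "x \<in> U" "y \<in> U" "?ends e = {x, y}" using pairs[OF e] by blast
      have xy_linked: "linked ?ends ?D x y" using e xy by (blast intro: linked_edge)
      obtain C1 where C1: "circuit ?ends C1" "C1 \<subseteq> ?D - {e}"
        "\<And>e' z. e' \<in> C1 \<Longrightarrow> z \<in> ?ends e' \<Longrightarrow> linked ?ends (?D - {e}) x z"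
        using circuit_of_vanishing[OF v xy(1)] by blast
      obtain C2 where C2: "circuit ?ends C2" "C2 \<subseteq> ?D - {e}"
        "\<And>e' z. e' \<in> C2 \<Longrightarrow> z \<in> ?ends e' \<Longrightarrow> linked ?ends (?D - {e}) y z"
        using circuit_of_vanishing[OF v xy(2)] by blast
      have in1: "inc C1 x"
        by (rule incI) (use C1 in \<open>blast intro: linked_mono\<close>)+
      have in2: "inc C2 x"
        by (rule incI) (use C2 xy_linked in \<open>blast intro: linked_mono linked_trans\<close>)+
      have "C1 = C2" using unique[OF xy(1) in1 in2] .
      obtain e' where e': "e' \<in> C1" using circuit_nonempty[OF C1(1)] by blast
      then obtain z where z: "z \<in> ?ends e'" using point C1 by blast
      have "linked ?ends (?D - {e}) x y"
        using C1(3)[OF e' z] C2(3)[of e' z] e' z \<open>C1 = C2\<close> by (blast intro: linked_trans linked_sym)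
      from circuit_through_edge[OF e xy(3) this]
      obtain C where C: "circuit ?ends C" "C \<subseteq> ?D" "e \<in> C"
        "\<And>e' z. e' \<in> C \<Longrightarrow> z \<in> ?ends e' \<Longrightarrow> linked ?ends ?D x z"
        by metis
      have "inc C x" by (rule incI) (use C in blast)+
      then have "C = C1" using unique[OF xy(1)] in1 by blast
      then show False using C C1 by blast
    qed
    ultimately show "?vanishing ?D \<and> (\<forall>e\<in>?D. \<not> ?vanishing (?D - {e}))" by blast
  next
    assume *: "?vanishing ?D \<and> (\<forall>e\<in>?D. \<not> ?vanishing (?D - {e}))"
    have "x \<in> mverts G" if x: "x \<in> U" for x
    proof (rule ccontr)
      assume "x \<notin> mverts G"
      then have "potential ?ends \<psi> ?D (\<lambda>y. if y = x then 1 else 0)"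
        unfolding potential_def verts by auto
      then have "(if x = x then 1 else 0) = (0::real)"
        using * x unfolding forces_zero_def by blast
      then show False by simp
    qed
    moreover have "mverts G \<subseteq> U" using pairs unfolding verts by fastforce
    ultimately have U: "mverts G = U" by blast
    have unbalanced: "cycle_gain \<psi> C \<noteq> 1" if C: "circuit ?ends C" "C \<subseteq> ?D" for C
    proof
      assume g: "cycle_gain \<psi> C = 1"
      obtain e where e: "e \<in> C" using circuit_nonempty[OF C(1)] by blast
      have "potential ?ends \<psi> ?D c" if "potential ?ends \<psi> (?D - {e}) c" for c
        by (rule potential_extends_over_balanced_circuit[of \<psi>, OF \<psi> C e g that])
      then have "?vanishing (?D - {e})" using * unfolding forces_zero_def by blast
      then show False using * e C by blast
    qed
    have subset: "C' \<subseteq> C" if C: "inc C a" and C': "inc C' a" for C C' a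
    proof
      fix e assume e: "e \<in> C'"
      show "e \<in> C"
      proof (rule ccontr)
        assume "e \<notin> C"
        have "?vanishing (?D - {e})"
          unfolding forces_zero_def
        proof (intro allI impI)
          fix c assume c: "potential ?ends \<psi> (?D - {e}) c"
          obtain f where f: "f \<in> C" using circuit_nonempty[OF incD(1)[OF C]] by blast
          then obtain z where z: "z \<in> ?ends f" using point incD(2)[OF C] by blast
          have "potential ?ends \<psi> C c"
            by (rule potential_mono[OF c]) (use incD(2)[OF C] \<open>e \<notin> C\<close> in blast)
          then have "c z = 0"
            using potential_vanishes_on_unbalanced_circuit[of \<psi> ?ends C c f z] \<psi> f z
              incD(1)[OF C] unbalanced[OF incD(1,2)[OF C]] by blast
          have "c x = 0" if x: "x \<in> ?ends e" for x
          proof -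
            have "linked ?ends ?D z x"
              using incD(3)[OF C f z] incD(3)[OF C' e x] by (blast intro: linked_trans linked_sym)
            then have "linked ?ends (?D - {e}) z x"
              using linked_avoiding_circuit_edge[OF incD(1,2)[OF C'] e] by blast
            then show ?thesis using potential_vanishes_linked[OF c] \<open>c z = 0\<close> by blast
          qed
          then have "c x = of_int (\<psi> e) * c y" if "?ends e = {x, y}" for x y
            using that by auto
          then have "potential ?ends \<psi> ?D c" using c unfolding potential_def by blast
          then show "\<forall>x\<in>U. c x = 0" using * unfolding forces_zero_def by blast
        qed
        then show False using * e incD(2)[OF C'] by blast
      qed
    qed
    have "\<exists>C. inc C a" if "a \<in> U" for a
      using circuit_of_vanishing[OF _ that] * unfolding inc_def by blast
    then have "\<exists>!C. inc C a" if "a \<in> U" for a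
      using subset that by (metis subset_antisym)
    moreover have "\<not> balanced G \<psi> C" if "inc C a" for C a
      using unbalanced incD(1,2)[OF that] unfolding balanced_def cyc by blast
    ultimately show "unbalanced_map_graph G \<psi> \<and> mverts G = U"
      unfolding unbalanced_map_graph_def comp U by blast
  qed
qed

section \<open>Flexes and motions for a quadrilateral norm\<close>

lemma quadrilateral_norm_swap:
  "quadrilateral_norm nrm f g \<Longrightarrow> quadrilateral_norm nrm g f"
  unfolding quadrilateral_norm_def quadrilateral_def by (simp add: Int_commute)

lemma phi_simps [simp]:
  "phi f (x + y) = phi f x + phi f y" "phi f (x - y) = phi f x - phi f y"
  "phi f (c *\<^sub>R x) = c * phi f x" "phi f (- x) = - phi f x" "phi f 0 = 0"
  unfolding phi_def by (simp_all add: inner_add_right inner_diff_right)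

lemma phi_coordinates_eqI:
  assumes "quadrilateral_norm nrm f g" "phi f x = phi f y" "phi g x = phi g y"
  shows "x = y"
proof -
  have "nrm (x - y) = 0" using quadrilateral_norm_eq_max[OF assms(1), of "x - y"] assms(2,3) by simp
  then show ?thesis using assms(1) unfolding quadrilateral_norm_def is_norm_def by auto
qed

lemma phi_coordinates_exist:
  assumes "quadrilateral_norm nrm f g"
  obtains x where "phi f x = a" "phi g x = b"
proof -
  let ?L = "\<lambda>x::real^2. \<chi> i::2. if i = 1 then phi f x else phi g x"
  have "linear ?L" by (rule linearI) (simp_all add: vec_eq_iff)
  moreover have "inj ?L"
    by (intro injI, rule phi_coordinates_eqI[OF assms]) (simp_all add: vec_eq_iff forall_2)
  ultimately have "surj ?L" by (rule linear_inj_imp_surj)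
  then obtain x where "(\<chi> i. if i = 1 then a else b) = ?L x" by (rule surjE)
  then have "phi f x = a" "phi g x = b" by (simp_all add: vec_eq_iff forall_2)
  then show thesis by (rule that)
qed

text \<open>
  The cone of \<open>F\<close> and \<open>-F\<close> is where the coordinate of \<open>F\<close> realises the maximum norm.
\<close>

lemma mem_cone_facets_iff:
  assumes q: "quadrilateral_norm nrm f g" and "d \<noteq> 0"
  defines "F \<equiv> facet {x. nrm x \<le> 1} f"
  shows "d \<in> cone hull F \<union> cone hull (uminus ` F) \<longleftrightarrow> \<bar>phi g d\<bar> \<le> \<bar>phi f d\<bar>"
proof -
  have F: "x \<in> F \<longleftrightarrow> phi f x = 1 \<and> \<bar>phi g x\<bar> \<le> 1" for x
    unfolding F_def facet_def using quadrilateral_norm_eq_max[OF q, of x]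
    by (auto simp: phi_def inner_commute)
  show ?thesis
  proof
    assume "d \<in> cone hull F \<union> cone hull (uminus ` F)"
    then obtain c x where "c \<ge> 0" "x \<in> F" "d = c *\<^sub>R x \<or> d = c *\<^sub>R (- x)"
      unfolding cone_hull_expl by auto
    then show "\<bar>phi g d\<bar> \<le> \<bar>phi f d\<bar>"
      unfolding F by (auto simp: abs_mult mult_left_le)
  next
    assume le: "\<bar>phi g d\<bar> \<le> \<bar>phi f d\<bar>"
    have nz: "phi f d \<noteq> 0"
      using phi_coordinates_eqI[OF q, of d 0] \<open>d \<noteq> 0\<close> le by auto
    define x where "x = (1 / phi f d) *\<^sub>R d"
    have x: "x \<in> F" unfolding F x_def using nz le by (simp add: abs_mult divide_le_eq)
    have d: "d = phi f d *\<^sub>R x" "d = (- phi f d) *\<^sub>R (- x)" unfolding x_def using nz by simp_all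
    show "d \<in> cone hull F \<union> cone hull (uminus ` F)"
    proof (cases "phi f d \<ge> 0")
      case True
      then have "d \<in> cone hull F" unfolding cone_hull_expl using d(1) x by blast
      then show ?thesis by blast
    next
      case False
      then have "- phi f d \<ge> 0" by simp
      then have "d \<in> cone hull (uminus ` F)" unfolding cone_hull_expl using d(2) x by blast
      then show ?thesis by blast
    qed
  qed
qed

lemma eventually_dominant:
  fixes g h :: "real \<Rightarrow> real"
  assumes "isCont g 0" "isCont h 0" "\<bar>h 0\<bar> < \<bar>g 0\<bar>"
  shows "\<forall>\<^sub>F t in nhds 0. \<bar>h t\<bar> < \<bar>g t\<bar> \<and> \<bar>g t\<bar> = sgn (g 0) * g t"
proof -
  have "((\<lambda>t. \<bar>g t\<bar> - \<bar>h t\<bar>) \<longlongrightarrow> \<bar>g 0\<bar> - \<bar>h 0\<bar>) (nhds 0)"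
    using assms(1,2) by (intro tendsto_intros) (auto simp: tendsto_at_iff_tendsto_nhds isCont_def)
  from order_tendstoD(1)[OF this, of 0]
  have 1: "\<forall>\<^sub>F t in nhds 0. \<bar>h t\<bar> < \<bar>g t\<bar>" using assms(3) by simp
  have "((\<lambda>t. g 0 * g t) \<longlongrightarrow> g 0 * g 0) (nhds 0)"
    using assms(1) by (intro tendsto_intros) (auto simp: tendsto_at_iff_tendsto_nhds isCont_def)
  moreover have "g 0 * g 0 > 0" using assms(3) by (auto simp: zero_less_mult_iff)
  ultimately have "\<forall>\<^sub>F t in nhds 0. 0 < g 0 * g t" by (rule order_tendstoD(1))
  with 1 show ?thesis
    by eventually_elim (auto simp: sgn_if zero_less_mult_iff abs_if)
qed

text \<open>
  Close to a vector with a strictly dominant coordinate the norm is, up to a sign, that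
  coordinate, hence linear.
\<close>

lemma norm_directional_derivative:
  assumes q: "quadrilateral_norm nrm f g" and d: "\<bar>phi g d\<bar> < \<bar>phi f d\<bar>"
  shows "((\<lambda>t. (1 / t) * (nrm (d + t *\<^sub>R h) - nrm d)) \<longlongrightarrow> sgn (phi f d) * phi f h) (at 0)"
proof -
  have "\<forall>\<^sub>F t in nhds 0. \<bar>phi g d + t * phi g h\<bar> < \<bar>phi f d + t * phi f h\<bar> \<and>
      \<bar>phi f d + t * phi f h\<bar> = sgn (phi f d) * (phi f d + t * phi f h)"
    using eventually_dominant[of "\<lambda>t. phi f d + t * phi f h" "\<lambda>t. phi g d + t * phi g h"] d
    by simp
  then have ev: "\<forall>\<^sub>F t in at 0. \<bar>phi g d + t * phi g h\<bar> < \<bar>phi f d + t * phi f h\<bar> \<and>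
      \<bar>phi f d + t * phi f h\<bar> = sgn (phi f d) * (phi f d + t * phi f h)"
    by (rule filter_leD[rotated]) (simp add: at_within_def)
  have nd: "nrm d = sgn (phi f d) * phi f d"
    using quadrilateral_norm_eq_max[OF q, of d] d by (simp add: abs_sgn mult.commute)
  have "\<forall>\<^sub>F t in at 0. sgn (phi f d) * phi f h = (1 / t) * (nrm (d + t *\<^sub>R h) - nrm d)"
    using ev eventually_neq_at_within[of 0]
  proof eventually_elim
    case (elim t)
    then show ?case
      using quadrilateral_norm_eq_max[OF q, of "d + t *\<^sub>R h"] nd by (simp add: field_simps)
  qed
  then show ?thesis by (rule Lim_transform_eventually[OF tendsto_const])
qed

text \<open>
  For small times the same coordinate of the difference of the two moving points remains
  dominant. Its modulus is then the norm of the difference, which does not change, and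
  continuity fixes its sign.
\<close>

lemma rigid_motion_dominant_coordinate:
  assumes q: "quadrilateral_norm nrm f g" and \<alpha>: "rigid_motion nrm \<alpha>"
    and d: "\<bar>phi g (x - y)\<bar> < \<bar>phi f (x - y)\<bar>"
  shows "phi f (vector_derivative (\<alpha> x) (at 0)) = phi f (vector_derivative (\<alpha> y) (at 0))"
proof -
  let ?\<eta> = "\<lambda>x. vector_derivative (\<alpha> x) (at 0)"
  have deriv: "(\<alpha> z has_vector_derivative ?\<eta> z) (at 0)" and start: "\<alpha> z 0 = z" for z
    using \<alpha> unfolding rigid_motion_def by (auto simp: vector_derivative_works[symmetric])
  have iso: "nrm (\<alpha> x t - \<alpha> y t) = nrm (x - y)" if "t \<in> {-1..1}" for t
    using \<alpha> that unfolding rigid_motion_def by blast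
  have diff: "((\<lambda>t. phi k (\<alpha> x t - \<alpha> y t)) has_real_derivative phi k (?\<eta> x - ?\<eta> y)) (at 0)" for k
    unfolding phi_def has_real_derivative_iff_has_vector_derivative
    by (rule bounded_linear.has_vector_derivative[OF bounded_linear_inner_right])
      (intro has_vector_derivative_diff deriv)
  have "\<forall>\<^sub>F t in nhds 0. \<bar>phi g (\<alpha> x t - \<alpha> y t)\<bar> < \<bar>phi f (\<alpha> x t - \<alpha> y t)\<bar> \<and>
      \<bar>phi f (\<alpha> x t - \<alpha> y t)\<bar> = sgn (phi f (\<alpha> x 0 - \<alpha> y 0)) * phi f (\<alpha> x t - \<alpha> y t)"
    by (rule eventually_dominant) (use DERIV_isCont[OF diff] d start in auto)
  moreover have "\<forall>\<^sub>F t in nhds 0. t \<in> {-1<..<1::real}"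
    by (rule eventually_nhds_in_open) auto
  ultimately have "\<forall>\<^sub>F t in nhds 0. phi f (\<alpha> x t - \<alpha> y t) = phi f (x - y)"
  proof eventually_elim
    case (elim t)
    have same: "\<bar>phi f (\<alpha> x t - \<alpha> y t)\<bar> = \<bar>phi f (x - y)\<bar>"
      using elim iso[of t] quadrilateral_norm_eq_max[OF q, of "\<alpha> x t - \<alpha> y t"]
        quadrilateral_norm_eq_max[OF q, of "x - y"] d by auto
    have "sgn (phi f (x - y)) * phi f (\<alpha> x t - \<alpha> y t) = \<bar>phi f (\<alpha> x t - \<alpha> y t)\<bar>"
      using elim start by simp
    also have "\<dots> = sgn (phi f (x - y)) * phi f (x - y)"
      by (subst same, subst abs_sgn, rule mult.commute)
    finally have "sgn (phi f (x - y)) * phi f (\<alpha> x t - \<alpha> y t) = sgn (phi f (x - y)) * phi f (x - y)" .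
    moreover have "sgn (phi f (x - y)) \<noteq> 0" using d by (auto simp: sgn_0_0)
    ultimately show ?case by simp
  qed
  then have "((\<lambda>t. phi f (\<alpha> x t - \<alpha> y t)) has_real_derivative 0) (at 0)"
    by (subst DERIV_cong_ev[OF refl _ refl, where g = "\<lambda>_. phi f (x - y)"]) auto
  from DERIV_unique[OF diff this] show ?thesis by simp
qed

text \<open>
  Two arbitrary points are compared with a third one that is so far away along the first
  coordinate axis that this coordinate dominates both differences.
\<close>

lemma rigid_motion_velocity_coordinate:
  assumes q: "quadrilateral_norm nrm f g" and \<alpha>: "rigid_motion nrm \<alpha>"
  shows "phi f (vector_derivative (\<alpha> x) (at 0)) = phi f (vector_derivative (\<alpha> y) (at 0))"
proof -
  obtain b where b: "phi f b = 1" "phi g b = 0" by (rule phi_coordinates_exist[OF q])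
  define M where "M = \<bar>phi f (x - y)\<bar> + \<bar>phi g (x - y)\<bar> + 1"
  define z where "z = x + M *\<^sub>R b"
  have "phi f (vector_derivative (\<alpha> z) (at 0)) = phi f (vector_derivative (\<alpha> x) (at 0))"
    by (rule rigid_motion_dominant_coordinate[OF q \<alpha>]) (simp add: z_def M_def b)
  moreover have "phi f (vector_derivative (\<alpha> z) (at 0)) = phi f (vector_derivative (\<alpha> y) (at 0))"
    by (rule rigid_motion_dominant_coordinate[OF q \<alpha>]) (simp add: z_def M_def b)
  ultimately show ?thesis by simp
qed

text \<open>
  This norm admits no infinitesimal rotations: a rigid motion has the same initial velocity at
  every point.
\<close>

lemma trivial_flex_iff_translation:
  assumes q: "quadrilateral_norm nrm f g"
  shows "trivial_flex nrm p u \<longleftrightarrow> (\<exists>k. \<forall>v. u $ v = k)"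
proof
  assume "trivial_flex nrm p u"
  then obtain \<alpha> where \<alpha>: "rigid_motion nrm \<alpha>" "u = (\<chi> v. vector_derivative (\<alpha> (p $ v)) (at 0))"
    unfolding trivial_flex_def by blast
  have "u $ v = vector_derivative (\<alpha> 0) (at 0)" for v
    using rigid_motion_velocity_coordinate[OF q \<alpha>(1), of "p $ v" 0]
      rigid_motion_velocity_coordinate[OF quadrilateral_norm_swap[OF q] \<alpha>(1), of "p $ v" 0]
    by (intro phi_coordinates_eqI[OF q]) (simp_all add: \<alpha>(2))
  then show "\<exists>k. \<forall>v. u $ v = k" by blast
next
  assume "\<exists>k. \<forall>v. u $ v = k"
  then obtain k where k: "\<And>v. u $ v = k" by blast
  define \<alpha> where "\<alpha> = (\<lambda>(x::real^2) (t::real). x + t *\<^sub>R k)"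
  have d: "(\<alpha> x has_vector_derivative k) (at 0)" for x
    unfolding \<alpha>_def by (auto intro!: derivative_eq_intros)
  have "rigid_motion nrm \<alpha>"
    unfolding rigid_motion_def
  proof (intro conjI allI ballI)
    show "continuous_on {- 1..1} (\<alpha> x)" for x unfolding \<alpha>_def by (intro continuous_intros)
    show "\<alpha> x differentiable at 0" for x using d by (rule differentiableI_vector)
  qed (simp_all add: \<alpha>_def)
  moreover have "u = (\<chi> v. vector_derivative (\<alpha> (p $ v)) (at 0))"
    using vector_derivative_at[OF d] k by (simp add: vec_eq_iff)
  ultimately show "trivial_flex nrm p u" unfolding trivial_flex_def by blast
qed

lemma rigidity_map_nth:
  assumes "is_norm nrm" "{v, w} \<in> H" "v \<noteq> w"
  shows "rigidity_map nrm H x $ {v, w} = nrm (x $ v - x $ w)"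
  unfolding rigidity_map_def using assms by (simp add: edge_length_doubleton)

text \<open>
  An edge constrains only one coordinate of a flex, namely the one that measures its length.
\<close>

lemma infinitesimal_flex_iff:
  assumes q: "quadrilateral_norm nrm f g" and H: "simple_graph H"
    and ne: "\<And>v w. {v, w} \<in> H \<Longrightarrow> \<bar>phi f (p $ v - p $ w)\<bar> \<noteq> \<bar>phi g (p $ v - p $ w)\<bar>"
  shows "infinitesimal_flex nrm H p u \<longleftrightarrow> (\<forall>v w. {v, w} \<in> H \<longrightarrow>
    (\<bar>phi g (p $ v - p $ w)\<bar> < \<bar>phi f (p $ v - p $ w)\<bar> \<longrightarrow> phi f (u $ v) = phi f (u $ w)) \<and>
    (\<bar>phi f (p $ v - p $ w)\<bar> < \<bar>phi g (p $ v - p $ w)\<bar> \<longrightarrow> phi g (u $ v) = phi g (u $ w)))"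
    (is "_ \<longleftrightarrow> ?R")
proof -
  have nrm: "is_norm nrm" using q unfolding quadrilateral_norm_def by blast
  let ?q = "\<lambda>t::real. (1 / t) *\<^sub>R (rigidity_map nrm H (p + t *\<^sub>R u) - rigidity_map nrm H p)"
  have edge: "((\<lambda>t. ?q t $ {v, w}) \<longlongrightarrow> 0) (at 0) \<longleftrightarrow> phi f' (u $ v) = phi f' (u $ w)"
    if e: "{v, w} \<in> H" and q': "quadrilateral_norm nrm f' g'"
      and dom: "\<bar>phi g' (p $ v - p $ w)\<bar> < \<bar>phi f' (p $ v - p $ w)\<bar>" for v w f' g'
  proof -
    have vw: "v \<noteq> w" using H e unfolding simple_graph_def by (metis doubleton_eq_iff)
    let ?d = "p $ v - p $ w" and ?h = "u $ v - u $ w"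
    have quotient: "?q t $ {v, w} = (1 / t) * (nrm (?d + t *\<^sub>R ?h) - nrm ?d)" for t
      using rigidity_map_nth[OF nrm e vw] by (simp add: algebra_simps)
    have lim: "((\<lambda>t. ?q t $ {v, w}) \<longlongrightarrow> sgn (phi f' ?d) * phi f' ?h) (at 0)"
      unfolding quotient by (rule norm_directional_derivative[OF q' dom])
    have "sgn (phi f' ?d) \<noteq> 0" using dom by (auto simp: sgn_0_0)
    then have "sgn (phi f' ?d) * phi f' ?h = 0 \<longleftrightarrow> phi f' (u $ v) = phi f' (u $ w)" by simp
    moreover have "((\<lambda>t. ?q t $ {v, w}) \<longlongrightarrow> 0) (at 0) \<longleftrightarrow> sgn (phi f' ?d) * phi f' ?h = 0"
    proof
      assume "((\<lambda>t. ?q t $ {v, w}) \<longlongrightarrow> 0) (at 0)"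
      from tendsto_unique[OF _ lim this] show "sgn (phi f' ?d) * phi f' ?h = 0" by simp
    next
      assume "sgn (phi f' ?d) * phi f' ?h = 0"
      with lim show "((\<lambda>t. ?q t $ {v, w}) \<longlongrightarrow> 0) (at 0)" by (simp only:)
    qed
    ultimately show ?thesis by blast
  qed
  have "infinitesimal_flex nrm H p u \<longleftrightarrow> (\<forall>e. ((\<lambda>t. ?q t $ e) \<longlongrightarrow> 0) (at 0))"
    (is "_ \<longleftrightarrow> ?C")
  proof
    assume "infinitesimal_flex nrm H p u"
    then have "(?q \<longlongrightarrow> 0) (at 0)" unfolding infinitesimal_flex_def .
    from tendsto_vec_nth[OF this] show ?C by (simp only: zero_index simp_thms)
  next
    assume ?C
    then have "(?q \<longlongrightarrow> 0) (at 0)" by (intro vec_tendstoI) (simp only: zero_index simp_thms)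
    then show "infinitesimal_flex nrm H p u" unfolding infinitesimal_flex_def .
  qed
  also have "\<dots> \<longleftrightarrow> (\<forall>e\<in>H. ((\<lambda>t. ?q t $ e) \<longlongrightarrow> 0) (at 0))"
  proof -
    have "((\<lambda>t. ?q t $ e) \<longlongrightarrow> 0) (at 0)" if "e \<notin> H" for e
      using that by (simp add: rigidity_map_def)
    then show ?thesis by blast
  qed
  also have "\<dots> \<longleftrightarrow> ?R"
  proof
    assume *: "\<forall>e\<in>H. ((\<lambda>t. ?q t $ e) \<longlongrightarrow> 0) (at 0)"
    show ?R using edge[OF _ q] edge[OF _ quadrilateral_norm_swap[OF q]] * by blast
  next
    assume *: ?R
    show "\<forall>e\<in>H. ((\<lambda>t. ?q t $ e) \<longlongrightarrow> 0) (at 0)"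
    proof
      fix e assume e: "e \<in> H"
      then obtain v w where vw: "e = {v, w}" using H unfolding simple_graph_def by blast
      then have "{v, w} \<in> H" using e by simp
      from ne[OF this] have "\<bar>phi g (p $ v - p $ w)\<bar> < \<bar>phi f (p $ v - p $ w)\<bar> \<or>
            \<bar>phi f (p $ v - p $ w)\<bar> < \<bar>phi g (p $ v - p $ w)\<bar>"
        by linarith
      then show "((\<lambda>t. ?q t $ e) \<longlongrightarrow> 0) (at 0)"
      proof
        assume dom: "\<bar>phi g (p $ v - p $ w)\<bar> < \<bar>phi f (p $ v - p $ w)\<bar>"
        show ?thesis
          unfolding vw by (rule edge[OF _ q dom, THEN iffD2]) (use * e dom vw in blast)+
      next
        assume dom: "\<bar>phi f (p $ v - p $ w)\<bar> < \<bar>phi g (p $ v - p $ w)\<bar>"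
        show ?thesis
          unfolding vw by (rule edge[OF _ quadrilateral_norm_swap[OF q] dom, THEN iffD2])
            (use * e dom vw in blast)+
      qed
    qed
  qed
  finally show ?thesis .
qed

text \<open>
  If both coordinates of an edge vector had the same modulus, moving one end so as to stretch
  the first coordinate only would lengthen the edge, while shrinking it would keep the length.
  The length would have different one-sided derivatives.
\<close>

lemma well_positioned_coordinates_differ:
  assumes q: "quadrilateral_norm nrm f g" and wp: "well_positioned nrm E p"
    and e: "{v, w} \<in> E" "v \<noteq> w" "p $ v \<noteq> p $ w"
  shows "\<bar>phi f (p $ v - p $ w)\<bar> \<noteq> \<bar>phi g (p $ v - p $ w)\<bar>"
proof
  let ?d = "p $ v - p $ w"
  assume eq: "\<bar>phi f ?d\<bar> = \<bar>phi g ?d\<bar>"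
  have nrm: "is_norm nrm" using q unfolding quadrilateral_norm_def by blast
  define m where "m = phi f ?d"
  have "m \<noteq> 0" using phi_coordinates_eqI[OF q, of ?d 0] eq e(3) unfolding m_def by auto
  obtain h where h: "phi f h = m" "phi g h = 0" by (rule phi_coordinates_exist[OF q])
  have stretch: "nrm (?d + t *\<^sub>R h) = \<bar>m\<bar> * max \<bar>1 + t\<bar> 1" for t
  proof -
    have "nrm (?d + t *\<^sub>R h) = max \<bar>m * (1 + t)\<bar> \<bar>m\<bar>"
      using quadrilateral_norm_eq_max[OF q, of "?d + t *\<^sub>R h"] h eq
      by (simp add: m_def algebra_simps)
    then show ?thesis by (simp add: abs_mult max_mult_distrib_left)
  qed
  have "(\<lambda>t::real. p + t *\<^sub>R axis v h) differentiable (at 0)" by simp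
  moreover have "rigidity_map nrm E differentiable (at (p + 0 *\<^sub>R axis v h))"
    using wp unfolding well_positioned_def by simp
  ultimately have "(rigidity_map nrm E \<circ> (\<lambda>t::real. p + t *\<^sub>R axis v h)) differentiable (at 0)"
    by (rule differentiable_chain_at)
  then have "(\<lambda>t. (rigidity_map nrm E \<circ> (\<lambda>t::real. p + t *\<^sub>R axis v h)) t $ {v, w}) differentiable (at 0)"
    by (rule differentiable_compose[rotated]) (simp add: bounded_linear_imp_differentiable bounded_linear_vec_nth)
  moreover have "(rigidity_map nrm E \<circ> (\<lambda>t::real. p + t *\<^sub>R axis v h)) t $ {v, w} = \<bar>m\<bar> * max \<bar>1 + t\<bar> 1" for t
    using rigidity_map_nth[OF nrm e(1,2)] stretch[of t] e(2) by (simp add: axis_def algebra_simps)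
  ultimately have "(\<lambda>t. \<bar>m\<bar> * max \<bar>1 + t\<bar> 1) differentiable (at (0::real))" by simp
  then obtain D where "((\<lambda>t. \<bar>m\<bar> * max \<bar>1 + t\<bar> 1) has_real_derivative D) (at 0)"
    using real_differentiable_def by blast
  then have lim: "((\<lambda>t. (\<bar>m\<bar> * max \<bar>1 + t\<bar> 1 - \<bar>m\<bar>) / t) \<longlongrightarrow> D) (at 0)"
    unfolding DERIV_def by simp
  have right: "((\<lambda>t. (\<bar>m\<bar> * max \<bar>1 + t\<bar> 1 - \<bar>m\<bar>) / t) \<longlongrightarrow> \<bar>m\<bar>) (at_right 0)"
    by (rule tendsto_eventually, rule eventually_at_rightI[of 0 1]) (auto simp: field_simps)
  have left: "((\<lambda>t. (\<bar>m\<bar> * max \<bar>1 + t\<bar> 1 - \<bar>m\<bar>) / t) \<longlongrightarrow> 0) (at_left 0)"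
    by (rule tendsto_eventually, rule eventually_at_leftI[of "-1"]) auto
  have "D = \<bar>m\<bar>"
    by (rule tendsto_unique[OF _ tendsto_mono[OF at_le lim] right]) simp_all
  moreover have "D = 0"
    by (rule tendsto_unique[OF _ tendsto_mono[OF at_le lim] left]) simp_all
  ultimately show False using \<open>m \<noteq> 0\<close> by simp
qed

section \<open>Frameworks with reflection symmetry\<close>

lemma vorbit_eq_iff:
  assumes "\<And>v. \<theta> (-1) (\<theta> (-1) v) = v"
  shows "vorbit \<theta> v = vorbit \<theta> w \<longleftrightarrow> w = v \<or> w = \<theta> (-1) v"
  unfolding vorbit_def using assms by (auto simp: doubleton_eq_iff)

lemma mends_quotient_graph:
  assumes inv: "\<And>v. \<theta> (-1) (\<theta> (-1) v) = v"
  shows "mends (quotient_graph \<theta> E) (eorbit \<theta> {v, w}) = {vorbit \<theta> v, vorbit \<theta> w}"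
proof -
  have "(\<exists>e\<in>eorbit \<theta> {v, w}. \<exists>x\<in>vorbit \<theta> z. x \<in> e) \<longleftrightarrow>
      vorbit \<theta> z = vorbit \<theta> v \<or> vorbit \<theta> z = vorbit \<theta> w" for z
    unfolding vorbit_eq_iff[of \<theta>, OF inv] unfolding eorbit_def vorbit_def
    using inv by auto metis+
  then show ?thesis unfolding quotient_graph_def by auto
qed

lemma potential_quotient_iff:
  assumes inv: "\<And>v. \<theta> (-1) (\<theta> (-1) v) = v" and K: "simple_graph K"
  shows "potential (mends (quotient_graph \<theta> E)) \<psi> (eorbit \<theta> ` K) c \<longleftrightarrow>
    (\<forall>v w. {v, w} \<in> K \<longrightarrow> c (vorbit \<theta> v) = of_int (\<psi> (eorbit \<theta> {v, w})) * c (vorbit \<theta> w))"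
    (is "_ \<longleftrightarrow> ?R")
proof
  assume *: "potential (mends (quotient_graph \<theta> E)) \<psi> (eorbit \<theta> ` K) c"
  show ?R
  proof (intro allI impI)
    fix v w assume "{v, w} \<in> K"
    then have "eorbit \<theta> {v, w} \<in> eorbit \<theta> ` K" by (rule imageI)
    then show "c (vorbit \<theta> v) = of_int (\<psi> (eorbit \<theta> {v, w})) * c (vorbit \<theta> w)"
      using * mends_quotient_graph[of \<theta>, OF inv, of E v w] unfolding potential_def by blast
  qed
next
  assume R: ?R
  show "potential (mends (quotient_graph \<theta> E)) \<psi> (eorbit \<theta> ` K) c"
    unfolding potential_def
  proof (intro ballI allI impI)
    fix X x y assume "X \<in> eorbit \<theta> ` K" and X: "mends (quotient_graph \<theta> E) X = {x, y}"
    then obtain e' where e': "e' \<in> K" "X = eorbit \<theta> e'" by (elim imageE)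
    then obtain v w where "e' = {v, w}" using K unfolding simple_graph_def by blast
    then have e: "{v, w} \<in> K" "X = eorbit \<theta> {v, w}" using e' by simp_all
    then have "x = vorbit \<theta> v \<and> y = vorbit \<theta> w \<or> x = vorbit \<theta> w \<and> y = vorbit \<theta> v"
      using X mends_quotient_graph[of \<theta>, OF inv, of E v w] by (auto simp: doubleton_eq_iff)
    moreover have e': "{w, v} \<in> K" "X = eorbit \<theta> {w, v}" using e by (simp_all add: insert_commute)
    ultimately show "c x = of_int (\<psi> X) * c y"
      using R[rule_format, OF e(1)] R[rule_format, OF e'(1)] e(2) e'(2) by auto
  qed
qed

text \<open>
  The gain of an edge orbit is the coboundary of the sign that tells whether a vertex is the
  chosen representative of its orbit. This sign turns functions on vertex orbits into functions
  on vertices that change sign under the action.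
\<close>

lemma gain_eq_representative_signs:
  assumes inv: "\<And>v. \<theta> (-1) (\<theta> (-1) v) = v" and R: "vertex_orbit_representatives \<theta> R"
    and free: "acts_freely \<theta>"
  defines "r \<equiv> \<lambda>v. if v \<in> R then 1 else -1"
  shows "r (\<theta> (-1) v) = - r v" and "gain R (eorbit \<theta> {v, w}) = r v * r w"
proof -
  have one: "\<theta> (-1) v \<in> R \<longleftrightarrow> v \<notin> R" for v
  proof -
    have "\<exists>!x. x \<in> R \<and> x \<in> vorbit \<theta> v"
      using R unfolding vertex_orbit_representatives_def by simp
    then obtain x where x: "x \<in> R" "x \<in> vorbit \<theta> v"
      "\<And>y. y \<in> R \<Longrightarrow> y \<in> vorbit \<theta> v \<Longrightarrow> y = x" by (elim ex1E) blast
    moreover have "v \<noteq> \<theta> (-1) v" using free unfolding acts_freely_def by simp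
    moreover have "v \<in> R \<Longrightarrow> v = x" "\<theta> (-1) v \<in> R \<Longrightarrow> \<theta> (-1) v = x"
      using x(3) by (simp_all add: vorbit_def)
    moreover have "x = v \<or> x = \<theta> (-1) v" using x(2) by (simp add: vorbit_def)
    ultimately show ?thesis by metis
  qed
  then show "r (\<theta> (-1) v) = - r v" unfolding r_def by simp
  show "gain R (eorbit \<theta> {v, w}) = r v * r w"
    unfolding gain_def eorbit_def r_def using one by simp
qed

locale reflection_symmetric_framework =
  fixes nrm :: "real ^ 2 \<Rightarrow> real"
    and f1 f2 :: "real ^ 2"
    and E :: "'v::finite set set"
    and \<theta> :: "int \<Rightarrow> 'v \<Rightarrow> 'v"
    and \<tau> :: "int \<Rightarrow> real ^ 2 \<Rightarrow> real ^ 2"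
    and p :: "(real ^ 2) ^ 'v"
    and R :: "'v set"
  assumes quad: "quadrilateral_norm nrm f1 f2"
    and symmetric: "Z2_symmetric_framework nrm E \<theta> \<tau> p"
    and well_pos: "well_positioned nrm E p"
    and free: "acts_freely \<theta>"
    and reflection: "is_reflection (\<tau> (-1)) {x. phi f1 x = 0} {x. phi f2 x = 0}"
    and representatives: "vertex_orbit_representatives \<theta> R"
begin

abbreviation neg :: "'v \<Rightarrow> 'v" where "neg \<equiv> \<theta> (-1)"
abbreviation "F1 \<equiv> facet {x. nrm x \<le> 1} f1"
abbreviation "F2 \<equiv> facet {x. nrm x \<le> 1} f2"
abbreviation "coloured F H \<equiv> {e \<in> H. has_colour p F e}"
abbreviation "ends \<equiv> mends (quotient_graph \<theta> E)"

lemma simple: "simple_graph E"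
  using symmetric unfolding Z2_symmetric_framework_def Z2_symmetric_graph_def by blast

lemma theta_hom: "\<theta> \<in> hom Z2 (graph_aut E)"
  using symmetric unfolding Z2_symmetric_framework_def Z2_symmetric_graph_def by blast

lemma theta_mult: "a \<in> {1, -1} \<Longrightarrow> b \<in> {1, -1} \<Longrightarrow> \<theta> (a * b) = \<theta> a \<circ> \<theta> b"
  using theta_hom unfolding hom_def Z2_def graph_aut_def by auto

lemma theta_one: "\<theta> 1 v = v"
proof -
  have "bij (\<theta> 1)" using theta_hom unfolding hom_def Z2_def graph_aut_def by auto
  moreover have "\<theta> 1 (\<theta> 1 v) = \<theta> 1 v" using theta_mult[of 1 1] by (simp add: fun_eq_iff)
  ultimately show ?thesis by (metis bij_pointE)
qed

lemma neg_neg: "neg (neg v) = v"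
  using theta_mult[of "-1" "-1"] theta_one by (simp add: fun_eq_iff)

lemma neg_edge: "{neg v, neg w} \<in> E \<longleftrightarrow> {v, w} \<in> E"
  using theta_hom unfolding hom_def Z2_def graph_aut_def by auto

lemma p_neg: "p $ neg v = \<tau> (-1) (p $ v)"
  using symmetric unfolding Z2_symmetric_framework_def by simp

text \<open>
  The reflection negates the coordinate that vanishes on its mirror and preserves the other one.
  An anti-symmetric flex is therefore invariant in its first coordinate and changes sign in its
  second coordinate.
\<close>

lemma phi_reflect: "phi f1 (\<tau> (-1) x) = - phi f1 x" "phi f2 (\<tau> (-1) x) = phi f2 x"
proof -
  obtain P where P: "linear P" "P \<circ> P = P" "range P = {x. phi f2 x = 0}"
    "{x. P x = 0} = {x. phi f1 x = 0}" "\<And>x. \<tau> (-1) x = x - 2 *\<^sub>R P x"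
    using reflection unfolding is_reflection_def by blast
  have "P (x - P x) = 0" using P(1,2) by (simp add: linear_diff fun_eq_iff)
  then have "phi f1 (x - P x) = 0" using P(4) by blast
  then show "phi f1 (\<tau> (-1) x) = - phi f1 x" by (simp add: P(5))
  have "phi f2 (P x) = 0" using P(3) by blast
  then show "phi f2 (\<tau> (-1) x) = phi f2 x" by (simp add: P(5))
qed

lemma edge_distinct: "{v, w} \<in> E \<Longrightarrow> v \<noteq> w"
  using simple unfolding simple_graph_def by (metis doubleton_eq_iff)

lemma edge_placed: "{v, w} \<in> E \<Longrightarrow> p $ v - p $ w \<noteq> 0"
  using symmetric unfolding Z2_symmetric_framework_def framework_def by auto

lemma edge_coordinates_differ:
  "{v, w} \<in> E \<Longrightarrow> \<bar>phi f1 (p $ v - p $ w)\<bar> \<noteq> \<bar>phi f2 (p $ v - p $ w)\<bar>"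
  using well_positioned_coordinates_differ[OF quad well_pos] edge_distinct edge_placed
  by simp

lemma has_colour_iff:
  assumes q: "quadrilateral_norm nrm f g" and e: "{v, w} \<in> E"
  shows "has_colour p (facet {x. nrm x \<le> 1} f) {v, w} \<longleftrightarrow>
    \<bar>phi g (p $ v - p $ w)\<bar> \<le> \<bar>phi f (p $ v - p $ w)\<bar>"
proof -
  have "{w, v} \<in> E" using e by (simp add: insert_commute)
  note mem_cone_facets_iff[OF q edge_placed[OF e]] mem_cone_facets_iff[OF q edge_placed[OF this]]
  moreover have "\<bar>phi k (p $ w - p $ v)\<bar> = \<bar>phi k (p $ v - p $ w)\<bar>" for k
    by (simp add: abs_minus_commute)
  ultimately show ?thesis
    unfolding has_colour_def using edge_distinct[OF e] by (metis doubleton_eq_iff)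
qed

lemma colour1: "{v, w} \<in> E \<Longrightarrow> has_colour p F1 {v, w} \<longleftrightarrow>
    \<bar>phi f2 (p $ v - p $ w)\<bar> < \<bar>phi f1 (p $ v - p $ w)\<bar>"
  using has_colour_iff[OF quad] edge_coordinates_differ by (metis order_less_le)

lemma colour2: "{v, w} \<in> E \<Longrightarrow> has_colour p F2 {v, w} \<longleftrightarrow>
    \<bar>phi f1 (p $ v - p $ w)\<bar> < \<bar>phi f2 (p $ v - p $ w)\<bar>"
  using has_colour_iff[OF quadrilateral_norm_swap[OF quad]] edge_coordinates_differ
  by (metis order_less_le)

text \<open>
  The two ends of a fixed edge are mirror images of each other, so they have the same second
  coordinate.
\<close>

lemma fixed_edge_colour: "{v, neg v} \<in> E \<Longrightarrow> \<not> has_colour p F2 {v, neg v}"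
  by (simp add: colour2 p_neg phi_reflect)

lemma edgeE:
  assumes "e \<in> E" obtains v w where "e = {v, w}" "v \<noteq> w"
  using assms simple unfolding simple_graph_def by blast

lemma one_colour:
  assumes "e \<in> E" shows "has_colour p F1 e \<longleftrightarrow> \<not> has_colour p F2 e"
proof -
  from assms obtain v w where "e = {v, w}" by (rule edgeE)
  then show ?thesis using colour1[of v w] colour2[of v w] edge_coordinates_differ[of v w] assms
    by (metis not_less_iff_gr_or_eq)
qed

lemma neg_image_edge:
  assumes "e \<in> E" shows "neg ` e \<in> E"
proof -
  from assms obtain v w where "e = {v, w}" by (rule edgeE)
  then show ?thesis using neg_edge[of v w] assms by simp
qed

lemma colour_neg:
  assumes "e \<in> E" shows "has_colour p F2 (neg ` e) \<longleftrightarrow> has_colour p F2 e"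
proof -
  from assms obtain v w where e: "e = {v, w}" by (rule edgeE)
  have "\<bar>phi f1 (p $ neg v - p $ neg w)\<bar> = \<bar>phi f1 (p $ v - p $ w)\<bar>"
    by (simp add: p_neg phi_reflect abs_minus_commute)
  moreover have "phi f2 (p $ neg v - p $ neg w) = phi f2 (p $ v - p $ w)"
    by (simp add: p_neg phi_reflect)
  ultimately show ?thesis
    using colour2[of v w] colour2[of "neg v" "neg w"] neg_edge[of v w] assms by (simp add: e)
qed

lemma neg_image_image: "neg ` neg ` e = e"
  by (simp add: image_image neg_neg)

lemma eorbit_eq_iff: "eorbit \<theta> e = eorbit \<theta> e' \<longleftrightarrow> e' = e \<or> e' = neg ` e"
proof
  assume "eorbit \<theta> e = eorbit \<theta> e'"
  then have "e' \<in> eorbit \<theta> e" by (simp add: eorbit_def)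
  then show "e' = e \<or> e' = neg ` e" by (simp add: eorbit_def)
next
  assume "e' = e \<or> e' = neg ` e"
  then show "eorbit \<theta> e = eorbit \<theta> e'"
    by (elim disjE) (simp_all only: eorbit_def neg_image_image insert_commute)
qed

lemma colour_orbits_disjoint:
  "eorbit \<theta> ` coloured F1 E \<inter> eorbit \<theta> ` coloured F2 E = {}"
proof -
  have False if "e \<in> coloured F1 E" "e' \<in> coloured F2 E" "eorbit \<theta> e = eorbit \<theta> e'" for e e'
  proof -
    have "e' = e \<or> e' = neg ` e" using that(3) by (simp only: eorbit_eq_iff)
    then have "has_colour p F2 e" using that(1,2) colour_neg[of e] by auto
    then show False using that(1) one_colour[of e] by simp
  qed
  then show ?thesis by blast
qed

text \<open>
  The two coordinates of an anti-symmetric flex are independent. The first one descends to the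
  quotient as it is, the second one after multiplication by the sign of the representatives,
  and each satisfies the edge conditions of its own colour only. A translation is
  anti-symmetric only if its second coordinate vanishes, so rigidity makes the first coordinate
  constant and the second one zero.
\<close>

lemma antisymmetrically_rigid_iff:
  assumes H: "H \<subseteq> E"
  shows "antisymmetrically_rigid nrm H \<theta> \<tau> p \<longleftrightarrow>
    connects ends (range (vorbit \<theta>)) (eorbit \<theta> ` coloured F1 H) \<and>
    forces_zero ends (gain R) (range (vorbit \<theta>)) (eorbit \<theta> ` coloured F2 H)"
    (is "_ \<longleftrightarrow> ?connecting \<and> ?vanishing")
proof -
  define r where "r = (\<lambda>v. if v \<in> R then 1 else -1 :: int)"
  have r_neg: "r (neg v) = - r v" and gain: "gain R (eorbit \<theta> {v, w}) = r v * r w" for v w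
    using gain_eq_representative_signs[of \<theta>, OF neg_neg representatives free] unfolding r_def by blast+
  have simple_H: "simple_graph H" and simple_coloured: "simple_graph (coloured F H)" for F
    using simple H unfolding simple_graph_def by auto
  have flex: "infinitesimal_flex nrm H p u \<longleftrightarrow> (\<forall>v w. {v, w} \<in> H \<longrightarrow>
      (has_colour p F1 {v, w} \<longrightarrow> phi f1 (u $ v) = phi f1 (u $ w)) \<and>
      (has_colour p F2 {v, w} \<longrightarrow> phi f2 (u $ v) = phi f2 (u $ w)))" for u
  proof -
    have E: "{v, w} \<in> E" if "{v, w} \<in> H" for v w using H that by blast
    show ?thesis
      by (subst infinitesimal_flex_iff[OF quad simple_H edge_coordinates_differ[OF E]], assumption)
        (intro iff_allI imp_cong refl, simp add: colour1[OF E] colour2[OF E])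
  qed
  have pot1: "potential ends (\<lambda>_. 1) (eorbit \<theta> ` coloured F1 H) c \<longleftrightarrow>
      (\<forall>v w. {v, w} \<in> H \<longrightarrow> has_colour p F1 {v, w} \<longrightarrow> c (vorbit \<theta> v) = c (vorbit \<theta> w))" for c :: "'v set \<Rightarrow> real"
    by (subst potential_quotient_iff[of \<theta>, OF neg_neg simple_coloured]) auto
  have pot2: "potential ends (gain R) (eorbit \<theta> ` coloured F2 H) c \<longleftrightarrow>
      (\<forall>v w. {v, w} \<in> H \<longrightarrow> has_colour p F2 {v, w} \<longrightarrow>
        r v * c (vorbit \<theta> v) = r w * c (vorbit \<theta> w))" for c :: "'v set \<Rightarrow> real"
  proof -
    have "x = real_of_int (r v * r w) * y \<longleftrightarrow> r v * x = r w * y" for x y :: real and v w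
      unfolding r_def by auto
    then show ?thesis
      by (subst potential_quotient_iff[of \<theta>, OF neg_neg simple_coloured]) (auto simp: gain)
  qed
  have vorbit_neg: "vorbit \<theta> (neg v) = vorbit \<theta> v" for v
    using vorbit_eq_iff[of \<theta>, OF neg_neg] by blast
  note trivial = trivial_flex_iff_translation[OF quad]
  show ?thesis
  proof
    assume rigid: "antisymmetrically_rigid nrm H \<theta> \<tau> p"
    obtain b1 where b1: "phi f1 b1 = 1" "phi f2 b1 = 0" by (rule phi_coordinates_exist[OF quad])
    obtain b2 where b2: "phi f1 b2 = 0" "phi f2 b2 = 1" by (rule phi_coordinates_exist[OF quad])
    have ?connecting
      unfolding connects_def
    proof (intro allI impI ballI)
      fix c x y assume c: "potential ends (\<lambda>_. 1) (eorbit \<theta> ` coloured F1 H) c"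
        and xy: "x \<in> range (vorbit \<theta>)" "y \<in> range (vorbit \<theta>)"
      define u where "u = (\<chi> v. c (vorbit \<theta> v) *\<^sub>R b1)"
      have "antisymmetric \<theta> \<tau> u"
        unfolding antisymmetric_def
        by (intro allI phi_coordinates_eqI[OF quad]) (simp_all add: phi_reflect u_def vorbit_neg b1)
      moreover have "infinitesimal_flex nrm H p u"
        using c unfolding flex pot1 by (simp add: u_def b1)
      ultimately obtain k where "\<And>v. u $ v = k"
        using rigid unfolding antisymmetrically_rigid_def trivial by blast
      then have "phi f1 (u $ v) = phi f1 k" for v by simp
      then have "c (vorbit \<theta> v) = phi f1 k" for v by (simp add: u_def b1)
      then show "c x = c y" using xy by auto
    qed
    moreover have ?vanishing
      unfolding forces_zero_def
    proof (intro allI impI ballI)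
      fix c x assume c: "potential ends (gain R) (eorbit \<theta> ` coloured F2 H) c"
        and "x \<in> range (vorbit \<theta>)"
      then obtain v where x: "x = vorbit \<theta> v" by blast
      define u where "u = (\<chi> v. (r v * c (vorbit \<theta> v)) *\<^sub>R b2)"
      have "antisymmetric \<theta> \<tau> u"
        unfolding antisymmetric_def
        by (intro allI phi_coordinates_eqI[OF quad])
          (simp_all add: phi_reflect u_def vorbit_neg r_neg b2)
      moreover have "infinitesimal_flex nrm H p u"
        using c unfolding flex pot2 by (simp add: u_def b2)
      ultimately obtain k where "\<And>v. u $ v = k"
        using rigid unfolding antisymmetrically_rigid_def trivial by blast
      then have "phi f2 (u $ v) = phi f2 (u $ neg v)" by simp
      then have "real_of_int (r v) * c x = 0" by (simp add: u_def b2 vorbit_neg r_neg x)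
      then show "c x = 0" unfolding r_def by (auto split: if_splits)
    qed
    ultimately show "?connecting \<and> ?vanishing" ..
  next
    assume *: "?connecting \<and> ?vanishing"
    show "antisymmetrically_rigid nrm H \<theta> \<tau> p"
      unfolding antisymmetrically_rigid_def
    proof (intro allI impI)
      fix u assume u: "infinitesimal_flex nrm H p u \<and> antisymmetric \<theta> \<tau> u"
      have neg1: "phi f1 (u $ neg v) = phi f1 (u $ v)" and neg2: "phi f2 (u $ neg v) = - phi f2 (u $ v)" for v
        using u unfolding antisymmetric_def by (simp_all add: phi_reflect)
      define rep where "rep = (\<lambda>x. SOME v. vorbit \<theta> v = x)"
      have rep: "rep (vorbit \<theta> v) = v \<or> rep (vorbit \<theta> v) = neg v" for v
      proof -
        have "vorbit \<theta> (rep (vorbit \<theta> v)) = vorbit \<theta> v" unfolding rep_def by (rule someI) simp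
        then show ?thesis using vorbit_eq_iff[of \<theta>, OF neg_neg] by metis
      qed
      define c1 where "c1 = (\<lambda>x. phi f1 (u $ rep x))"
      define c2 where "c2 = (\<lambda>x. r (rep x) * phi f2 (u $ rep x))"
      have c1: "c1 (vorbit \<theta> v) = phi f1 (u $ v)" for v
        unfolding c1_def using rep[of v] neg1 by metis
      have c2: "c2 (vorbit \<theta> v) = r v * phi f2 (u $ v)" for v
        unfolding c2_def using rep[of v] by (auto simp: neg2 r_neg)
      have "potential ends (\<lambda>_. 1) (eorbit \<theta> ` coloured F1 H) c1"
        using u unfolding pot1 flex c1 by blast
      then have "c1 (vorbit \<theta> v) = c1 (vorbit \<theta> w)" for v w using * unfolding connects_def by blast
      then have const1: "phi f1 (u $ v) = phi f1 (u $ w)" for v w unfolding c1 .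
      have "potential ends (gain R) (eorbit \<theta> ` coloured F2 H) c2"
        using u unfolding pot2 flex c2 by (auto simp: r_def)
      then have "c2 (vorbit \<theta> v) = 0" for v using * unfolding forces_zero_def by blast
      then have "real_of_int (r v) * phi f2 (u $ v) = 0" for v unfolding c2 .
      moreover have "r v \<noteq> 0" for v by (simp add: r_def)
      ultimately have zero2: "phi f2 (u $ v) = 0" for v by simp
      have "u $ v = u $ w" for v w
        by (rule phi_coordinates_eqI[OF quad const1]) (simp add: zero2)
      then show "trivial_flex nrm p u" unfolding trivial by blast
    qed
  qed
qed

lemma eorbits_delete:
  "eorbit \<theta> ` coloured F (E - eorbit \<theta> e) = eorbit \<theta> ` coloured F E - {eorbit \<theta> e}"
proof -
  have "e' \<in> eorbit \<theta> e \<longleftrightarrow> e' = e \<or> e' = neg ` e" for e' by (simp add: eorbit_def)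
  then have "e' \<in> eorbit \<theta> e \<longleftrightarrow> eorbit \<theta> e' = eorbit \<theta> e" for e'
    by (simp only: eorbit_eq_iff[symmetric] eq_commute)
  then have "coloured F (E - eorbit \<theta> e) = {e' \<in> coloured F E. eorbit \<theta> e' \<noteq> eorbit \<theta> e}"
    by blast
  then show ?thesis by blast
qed

text \<open>
  Deleting an edge orbit affects one colour class only, so the minimality of the framework is the
  minimality of the two classes separately.
\<close>

lemma antisymmetrically_isostatic_iff:
  defines "D1 \<equiv> eorbit \<theta> ` coloured F1 E" and "D2 \<equiv> eorbit \<theta> ` coloured F2 E"
    and "U \<equiv> range (vorbit \<theta>)"
  shows "antisymmetrically_isostatic nrm E \<theta> \<tau> p \<longleftrightarrow>
    (connects ends U D1 \<and> (\<forall>X\<in>D1. \<not> connects ends U (D1 - {X}))) \<and>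
    (forces_zero ends (gain R) U D2 \<and> (\<forall>X\<in>D2. \<not> forces_zero ends (gain R) U (D2 - {X})))"
proof -
  have rigid: "antisymmetrically_rigid nrm H \<theta> \<tau> p \<longleftrightarrow>
      connects ends U (eorbit \<theta> ` coloured F1 H) \<and>
      forces_zero ends (gain R) U (eorbit \<theta> ` coloured F2 H)" if "H \<subseteq> E" for H
    unfolding U_def by (rule antisymmetrically_rigid_iff[OF that])
  have disjoint: "D1 \<inter> D2 = {}" unfolding D1_def D2_def by (rule colour_orbits_disjoint)
  show ?thesis
  proof
    assume iso: "antisymmetrically_isostatic nrm E \<theta> \<tau> p"
    have "antisymmetrically_rigid nrm E \<theta> \<tau> p"
      using iso unfolding antisymmetrically_isostatic_def by blast
    then have all: "connects ends U D1" "forces_zero ends (gain R) U D2"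
      unfolding D1_def D2_def using rigid[of E] by blast+
    have minimal: "\<not> (connects ends U (D1 - {eorbit \<theta> e}) \<and> forces_zero ends (gain R) U (D2 - {eorbit \<theta> e}))"
      if e: "e \<in> E" for e
    proof -
      let ?H = "E - eorbit \<theta> e"
      have "e \<in> eorbit \<theta> e" by (simp add: eorbit_def)
      then have "?H \<subset> E" using e by blast
      moreover have "\<theta> s ` e' \<in> ?H" if s: "s \<in> carrier Z2" and e': "e' \<in> ?H" for s e'
      proof (cases "s = 1")
        case True
        then show ?thesis using e' by (simp add: theta_one)
      next
        case False
        then have "s = -1" using s by (simp add: Z2_def)
        moreover have "neg ` e' \<notin> eorbit \<theta> e"
        proof
          assume "neg ` e' \<in> eorbit \<theta> e"
          then have "neg ` e' = e \<or> neg ` e' = neg ` e" by (simp add: eorbit_def)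
          then have "neg ` neg ` e' = neg ` e \<or> neg ` neg ` e' = neg ` neg ` e" by metis
          then have "e' = neg ` e \<or> e' = e" by (simp only: neg_image_image)
          then show False using e' by (simp add: eorbit_def)
        qed
        ultimately show ?thesis using e' neg_image_edge by simp
      qed
      ultimately have "\<not> antisymmetrically_rigid nrm ?H \<theta> \<tau> p"
        using iso unfolding antisymmetrically_isostatic_def by blast
      then show ?thesis
        unfolding D1_def D2_def rigid[OF Diff_subset] eorbits_delete .
    qed
    have "\<not> connects ends U (D1 - {X})" if X: "X \<in> D1" for X
    proof -
      obtain e where "e \<in> E" "X = eorbit \<theta> e" using X unfolding D1_def by blast
      moreover have "D2 - {X} = D2" using X disjoint by blast
      ultimately show ?thesis using minimal[of e] all by simp
    qed
    moreover have "\<not> forces_zero ends (gain R) U (D2 - {X})" if X: "X \<in> D2" for X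
    proof -
      obtain e where "e \<in> E" "X = eorbit \<theta> e" using X unfolding D2_def by blast
      moreover have "D1 - {X} = D1" using X disjoint by blast
      ultimately show ?thesis using minimal[of e] all by simp
    qed
    ultimately show "(connects ends U D1 \<and> (\<forall>X\<in>D1. \<not> connects ends U (D1 - {X}))) \<and>
        (forces_zero ends (gain R) U D2 \<and> (\<forall>X\<in>D2. \<not> forces_zero ends (gain R) U (D2 - {X})))"
      using all by blast
  next
    assume *: "(connects ends U D1 \<and> (\<forall>X\<in>D1. \<not> connects ends U (D1 - {X}))) \<and>
        (forces_zero ends (gain R) U D2 \<and> (\<forall>X\<in>D2. \<not> forces_zero ends (gain R) U (D2 - {X})))"
    have "\<not> antisymmetrically_rigid nrm H \<theta> \<tau> p"
      if H: "H \<subset> E" and inv: "\<forall>s\<in>carrier Z2. \<forall>e\<in>H. \<theta> s ` e \<in> H" for H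
    proof
      assume rigid_H: "antisymmetrically_rigid nrm H \<theta> \<tau> p"
      obtain e where e: "e \<in> E" "e \<notin> H" using H by blast
      have "eorbit \<theta> e' \<noteq> eorbit \<theta> e" if "e' \<in> H" for e'
      proof
        assume "eorbit \<theta> e' = eorbit \<theta> e"
        then have "e = e' \<or> e = neg ` e'" by (simp only: eorbit_eq_iff)
        moreover have "neg ` e' \<in> H" using inv that by (simp add: Z2_def)
        ultimately show False using e that by auto
      qed
      then have sub: "eorbit \<theta> ` coloured F1 H \<subseteq> D1 - {eorbit \<theta> e}"
        "eorbit \<theta> ` coloured F2 H \<subseteq> D2 - {eorbit \<theta> e}"
        using H unfolding D1_def D2_def by auto
      have "connects ends U (D1 - {eorbit \<theta> e})"
        using rigid_H rigid[of H] H connects_mono[OF _ sub(1)] by blast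
      moreover have "forces_zero ends (gain R) U (D2 - {eorbit \<theta> e})"
        using rigid_H rigid[of H] H forces_zero_mono[OF _ sub(2)] by blast
      moreover have "eorbit \<theta> e \<in> D1 \<or> eorbit \<theta> e \<in> D2"
        using e(1) one_colour unfolding D1_def D2_def by blast
      ultimately show False using * by blast
    qed
    moreover have "antisymmetrically_rigid nrm E \<theta> \<tau> p"
      unfolding rigid[OF subset_refl] using *[unfolded D1_def D2_def] by (elim conjE) (intro conjI)
    ultimately show "antisymmetrically_isostatic nrm E \<theta> \<tau> p"
      unfolding antisymmetrically_isostatic_def by blast
  qed
qed

lemma quotient_edge_ends:
  assumes "X \<in> eorbit \<theta> ` coloured F E"
  shows "\<exists>x\<in>range (vorbit \<theta>). \<exists>y\<in>range (vorbit \<theta>). ends X = {x, y}"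
proof -
  obtain e where "e \<in> E" "X = eorbit \<theta> e" using assms by blast
  moreover from this obtain v w where "e = {v, w}" using edgeE by blast
  ultimately have "ends X = {vorbit \<theta> v, vorbit \<theta> w}"
    using mends_quotient_graph[of \<theta>, OF neg_neg] by simp
  then show ?thesis by blast
qed

text \<open>
  Without edges of the second colour every function would be a potential. An edge of that colour
  is not fixed, so its ends lie in different orbits.
\<close>

lemma two_vertex_orbits:
  assumes "forces_zero ends (gain R) (range (vorbit \<theta>)) (eorbit \<theta> ` coloured F2 E)"
  obtains v w where "vorbit \<theta> v \<noteq> vorbit \<theta> w"
proof -
  have "coloured F2 E \<noteq> {}"
  proof
    assume none: "coloured F2 E = {}"
    have "potential ends (gain R) (eorbit \<theta> ` coloured F2 E) (\<lambda>_. 1)"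
      unfolding none potential_def by simp
    then have "\<forall>x\<in>range (vorbit \<theta>). (1::real) = 0"
      using assms unfolding forces_zero_def by blast
    then show False by simp
  qed
  then obtain e where e: "e \<in> E" "has_colour p F2 e" by blast
  then obtain v w where vw: "e = {v, w}" "v \<noteq> w" using edgeE by blast
  have "w \<noteq> neg v" using fixed_edge_colour[of v] e vw by auto
  then have "vorbit \<theta> v \<noteq> vorbit \<theta> w"
    using vw(2) vorbit_eq_iff[of \<theta>, OF neg_neg, of v w] by auto
  then show thesis by (rule that)
qed

lemma monochrome_quotient_simps [simp]:
  "mverts (monochrome_quotient \<theta> E p F) = \<Union> (ends ` eorbit \<theta> ` coloured F E)"
  "medges (monochrome_quotient \<theta> E p F) = eorbit \<theta> ` coloured F E"
  "mends (monochrome_quotient \<theta> E p F) = ends"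
  by (simp_all add: monochrome_quotient_def edge_subgraph_def)

lemma spanning_in_quotient_iff:
  "spanning_in G (quotient_graph \<theta> E) \<longleftrightarrow> mverts G = range (vorbit \<theta>)"
  by (simp add: spanning_in_def quotient_graph_def)

lemma isostatic_iff_tree_and_map_graph:
  "antisymmetrically_isostatic nrm E \<theta> \<tau> p \<longleftrightarrow>
    (is_tree (monochrome_quotient \<theta> E p F1) \<and>
     spanning_in (monochrome_quotient \<theta> E p F1) (quotient_graph \<theta> E)) \<and>
    (unbalanced_map_graph (monochrome_quotient \<theta> E p F2) (gain R) \<and>
     spanning_in (monochrome_quotient \<theta> E p F2) (quotient_graph \<theta> E))"
proof -
  let ?U = "range (vorbit \<theta>)"
  let ?D1 = "eorbit \<theta> ` coloured F1 E" and ?D2 = "eorbit \<theta> ` coloured F2 E"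
  let ?G1 = "monochrome_quotient \<theta> E p F1" and ?G2 = "monochrome_quotient \<theta> E p F2"
  have pairs: "\<exists>x\<in>?U. \<exists>y\<in>?U. mends (monochrome_quotient \<theta> E p F) X = {x, y}"
    if "X \<in> medges (monochrome_quotient \<theta> E p F)" for X F
    using that quotient_edge_ends by simp
  have gains: "gain R X = 1 \<or> gain R X = -1" for X by (simp add: gain_def)
  have map_graph: "unbalanced_map_graph ?G2 (gain R) \<and> mverts ?G2 = ?U \<longleftrightarrow>
      forces_zero ends (gain R) ?U ?D2 \<and> (\<forall>X\<in>?D2. \<not> forces_zero ends (gain R) ?U (?D2 - {X}))"
    using unbalanced_map_graph_iff_minimally_forces_zero[OF gains pairs, of F2]
    by simp
  have tree: "is_tree ?G1 \<and> mverts ?G1 = ?U \<longleftrightarrow>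
      connects ends ?U ?D1 \<and> (\<forall>X\<in>?D1. \<not> connects ends ?U (?D1 - {X}))"
    if zero: "forces_zero ends (gain R) ?U ?D2"
  proof -
    obtain v w where "vorbit \<theta> v \<noteq> vorbit \<theta> w" by (rule two_vertex_orbits[OF zero])
    then show ?thesis
      using is_tree_iff_minimally_connects[OF pairs, of F1 "vorbit \<theta> v" "vorbit \<theta> w"]
      by simp
  qed
  show ?thesis
    unfolding antisymmetrically_isostatic_iff spanning_in_quotient_iff map_graph
    using tree by blast
qed

end

theorem theorem16:
  fixes nrm :: "real ^ 2 \<Rightarrow> real"
    and f1 f2 :: "real ^ 2"
    and F1 F2 :: "(real ^ 2) set"
    and E :: "'v::finite set set"
    and \<theta> :: "int \<Rightarrow> 'v \<Rightarrow> 'v"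
    and \<tau> :: "int \<Rightarrow> real ^ 2 \<Rightarrow> real ^ 2"
    and p :: "(real ^ 2) ^ 'v"
    and R :: "'v set"
  assumes "quadrilateral_norm nrm f1 f2"
    and "F1 = facet {x. nrm x \<le> 1} f1"
    and "F2 = facet {x. nrm x \<le> 1} f2"
    and "Z2_symmetric_framework nrm E \<theta> \<tau> p"
    and "well_positioned nrm E p"
    and "acts_freely \<theta>"
    and "is_reflection (\<tau> (-1)) {x. phi f1 x = 0} {x. phi f2 x = 0}"
    and "vertex_orbit_representatives \<theta> R"
  shows "antisymmetrically_isostatic nrm E \<theta> \<tau> p \<longleftrightarrow>
    (is_tree (monochrome_quotient \<theta> E p F1) \<and>
     spanning_in (monochrome_quotient \<theta> E p F1) (quotient_graph \<theta> E)) \<and>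
    (unbalanced_map_graph (monochrome_quotient \<theta> E p F2) (gain R) \<and>
     spanning_in (monochrome_quotient \<theta> E p F2) (quotient_graph \<theta> E))"
proof -
  interpret reflection_symmetric_framework nrm f1 f2 E \<theta> \<tau> p R
    using assms by unfold_locales
  show ?thesis unfolding assms(2,3) by (rule isostatic_iff_tree_and_map_graph)
qed

end
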